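(* Let $\mathcal{P}$ be a finite regular polyhedral poset and let $\Bbbk[\mathcal{P}]$ denote its graded Stanley-Reisner algebra, where for each $x\in\mathcal{P}$ the corresponding generator has degree $|x|=|V_\mathcal{P}(x)|$. Then the Poincaré series of $\Bbbk[\mathcal{P}]$ is $$P_{\Bbbk[\mathcal{P}]}(t)=\sum_{i=-1}^\infty\frac{\left(f_i(\mathcal{P})+\sum_{k=i+1}^{\|\mathcal{P}\|}f_k(\mathcal{P})\,\nu_{i,k}(\mathcal{P})\right)t^{i+1}}{(1-t)^{i+1}}.$$
   Context: $\Bbbk$ is a commutative ring with unit. A poset $\mathcal{P}$ is regarded as a small category with exactly one morphism $\iota_{x,y}\colon x\to y$ whenever $x\le y$. It is pointed if it has an initial (least) object $*$. A vertex is an object $v\ne *$ such that $y<v$ implies $y=*$. $V_\mathcal{P}$ is the set of vertices, and $V(x)=V_\mathcal{P}(x)=\{v\in V_\mathcal{P}\mid v\le x\}$. $[x\vee y]$ is the set of minimal upper bounds of $\{x,y\}$, and $\mathcal{P}_{\le x}=\{y\mid y\le x\}$. A finite pointed poset is polyhedral if every $\mathcal{P}_{\le x}$ is a lower semilattice (any two objects have a meet). It is regular if $\mathcal{P}_{\le x}\cong\mathcal{P}_{\le y}$ whenever $|V(x)|=|V(y)|$. $\|\mathcal{P}\|=\max\{|V(x)| : x\in\mathcal{P}\}-1$, and $f_i(\mathcal{P})$ is the number of $x\in\mathcal{P}$ with $|V(x)|=i+1$; $f_{-1}(\mathcal{P})=1$. Numbers $\nu_{i,k}(\mathcal{P})$: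 $\nu_{-1,k}(\mathcal{P})=0$ and $\nu_{0,k}(\mathcal{P})=0$. For $1\le i<k$, fix $x\in\mathcal{P}$ with $|V(x)|=k+1$ (by regularity the choice does not matter); $\nu_{i,k}(\mathcal{P})$ is the number of objects $[x,S]$ of the simplicial transform $s(\mathcal{P}_{\le x})$ (equivalently, of subsets $S\subseteq V(x)$) such that $|S|=i+1$ and there is no $y\lneq x$ with $S\subseteq V(y)$. (If no such $x$ exists then $f_k(\mathcal{P})=0$ and the corresponding term is $0$.) For a finite pointed poset $\mathcal{Q}$, $s(\mathcal{Q})$ is the set of equivalence classes $[x,S]$ of pairs ($x\in\mathcal{Q}$, $S\subseteq V(x)$) under the transitive closure of $(x,S)\sim(y,T)$ if $S=T$ and $[x\vee y]\neq\emptyset$. Stanley-Reisner ring: $\Bbbk[\mathcal{P}]=\mathcal{T}_\mathcal{P}(\mathbf{e})=\lim_{\mathcal{P}}\mathcal{T}_{\mathcal{P},\mathbf{e}}$, where $\mathcal{T}_{\mathcal{P},\mathbf{e}}$ is the functor from $\mathcal{P}^{\mathrm{op}}$ to $\Bbbk$-algebras sending $p$ to the polynomial algebra $P_\Bbbk[V(p)]$ and sending $\iota_{p,q}$ ($p\le q$) to the map $P_\Bbbk[V(q)]\to P_\Bbbk[V(p)]$ that is the identity on $v\in V(p)$ and sends $v\in V(q)\setminus V(p)$ to $0$. The generator corresponding to $x\in\mathcal{P}$ is the element of the limit whose component at $y$ is $\prod_{v\in V(x)}v$ if $y\ge x$ and $0$ otherwise; thus the grading is the one in which each polynomial generator $v$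 has degree $1$. For a free graded $\Bbbk$-module $M$ with finite-rank homogeneous parts $M_n$, $P_M(t)=\sum_n \operatorname{rank}(M_n)t^n$. *)

theory Defs
  imports
    "HOL-Algebra.Lattice"
    "HOL-Library.Poly_Mapping"
    "HOL-Library.Function_Algebras"
    "HOL-Computational_Algebra.Formal_Power_Series"
begin

section \<open>Polyhedral posets\<close>

locale finite_pointed_poset = partial_order P + weak_partial_order_bottom P for P (structure) +
  assumes finite_carrier: "finite (carrier P)"

definition down :: "('a, 'b) gorder_scheme \<Rightarrow> 'a \<Rightarrow> ('a, 'b) gorder_scheme" where
  "down P x = P\<lparr>carrier := {y \<in> carrier P. y \<sqsubseteq>\<^bsub>P\<^esub> x}\<rparr>"

definition poset_vertices :: "('a, 'b) gorder_scheme \<Rightarrow> 'a set" where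
  "poset_vertices P =
    {v \<in> carrier P. v \<noteq> \<bottom>\<^bsub>P\<^esub> \<and> (\<forall>y \<in> carrier P. y \<sqsubset>\<^bsub>P\<^esub> v \<longrightarrow> y = \<bottom>\<^bsub>P\<^esub>)}"

definition vertices_below :: "('a, 'b) gorder_scheme \<Rightarrow> 'a \<Rightarrow> 'a set" where
  "vertices_below P x = {v \<in> poset_vertices P. v \<sqsubseteq>\<^bsub>P\<^esub> x}"

definition minimal_upper_bounds :: "('a, 'b) gorder_scheme \<Rightarrow> 'a \<Rightarrow> 'a \<Rightarrow> 'a set" where
  "minimal_upper_bounds P x y =
    {z \<in> Upper P {x, y}. \<forall>w \<in> Upper P {x, y}. w \<sqsubseteq>\<^bsub>P\<^esub> z \<longrightarrow> w = z}"

definition poset_isomorphic :: "('a, 'b) gorder_scheme \<Rightarrow> ('c, 'd) gorder_scheme \<Rightarrow> bool" where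
  "poset_isomorphic P Q \<longleftrightarrow>
    (\<exists>h. bij_betw h (carrier P) (carrier Q) \<and>
      (\<forall>x \<in> carrier P. \<forall>y \<in> carrier P. x \<sqsubseteq>\<^bsub>P\<^esub> y \<longleftrightarrow> h x \<sqsubseteq>\<^bsub>Q\<^esub> h y))"

locale polyhedral_poset = finite_pointed_poset P for P (structure) +
  assumes down_lower_semilattice: "x \<in> carrier P \<Longrightarrow> lower_semilattice (down P x)"

definition regular_poset :: "('a, 'b) gorder_scheme \<Rightarrow> bool" where
  "regular_poset P \<longleftrightarrow>
    (\<forall>x \<in> carrier P. \<forall>y \<in> carrier P.
      card (vertices_below P x) = card (vertices_below P y) \<longrightarrow>
      poset_isomorphic (down P x) (down P y))"


section \<open>The simplicial transform and the numerical invariants\<close>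

definition transform_pairs :: "('a, 'b) gorder_scheme \<Rightarrow> ('a \<times> 'a set) set" where
  "transform_pairs Q = {(x, S). x \<in> carrier Q \<and> S \<subseteq> vertices_below Q x}"

definition transform_step :: "('a, 'b) gorder_scheme \<Rightarrow> (('a \<times> 'a set) \<times> ('a \<times> 'a set)) set" where
  "transform_step Q =
    {((x, S), (y, T)). (x, S) \<in> transform_pairs Q \<and> (y, T) \<in> transform_pairs Q \<and>
      S = T \<and> minimal_upper_bounds Q x y \<noteq> {}}"

definition simplicial_transform :: "('a, 'b) gorder_scheme \<Rightarrow> ('a \<times> 'a set) set set" where
  "simplicial_transform Q = transform_pairs Q // (transform_step Q)\<^sup>+"

definition poset_norm :: "('a, 'b) gorder_scheme \<Rightarrow> int" where
  "poset_norm P = int (Max ((\<lambda>x. card (vertices_below P x)) ` carrier P)) - 1"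

definition f_num :: "('a, 'b) gorder_scheme \<Rightarrow> int \<Rightarrow> nat" where
  "f_num P i =
    (if i = - 1 then 1 else card {x \<in> carrier P. int (card (vertices_below P x)) = i + 1})"

definition nu_at :: "('a, 'b) gorder_scheme \<Rightarrow> int \<Rightarrow> 'a \<Rightarrow> nat" where
  "nu_at P i x =
    card {c \<in> simplicial_transform (down P x).
      \<exists>S. (x, S) \<in> c \<and> int (card S) = i + 1 \<and>
        \<not> (\<exists>y \<in> carrier P. y \<sqsubset>\<^bsub>P\<^esub> x \<and> S \<subseteq> vertices_below P y)}"

text \<open>For a regular poset the value does not depend on the \<open>x\<close> that is chosen. If there is no
  such \<open>x\<close>, the value is unspecified; then \<open>f_num P k = 0\<close>.\<close>
definition nu_num :: "('a, 'b) gorder_scheme \<Rightarrow> int \<Rightarrow> int \<Rightarrow> nat" where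
  "nu_num P i k =
    (if i = - 1 \<or> i = 0 then 0
     else nu_at P i (SOME x. x \<in> carrier P \<and> int (card (vertices_below P x)) = k + 1))"


section \<open>Polynomial algebras\<close>

text \<open>A polynomial is a finitely supported function from monomials (exponent vectors) to
  coefficients. All algebras \<open>P[A]\<close> are realised inside the one type of polynomials with arbitrary
  variables in \<open>'v\<close>.\<close>
type_synonym ('v, 'k) mpoly = "('v \<Rightarrow>\<^sub>0 nat) \<Rightarrow>\<^sub>0 'k"

definition mvar :: "'v \<Rightarrow> ('v, 'k::comm_ring_1) mpoly" where
  "mvar v = Poly_Mapping.single (Poly_Mapping.single v 1) 1"

definition mconst :: "'k \<Rightarrow> ('v, 'k::comm_ring_1) mpoly" where
  "mconst c = Poly_Mapping.single 0 c"

definition mpolys_in :: "'v set \<Rightarrow> ('v, 'k::comm_ring_1) mpoly set" where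
  "mpolys_in A = {f. \<forall>m \<in> Poly_Mapping.keys f. Poly_Mapping.keys m \<subseteq> A}"

text \<open>The algebra homomorphism that is determined by the images \<open>\<phi> v\<close> of the variables.\<close>
definition msubst :: "('v \<Rightarrow> ('v, 'k::comm_ring_1) mpoly) \<Rightarrow> ('v, 'k) mpoly \<Rightarrow> ('v, 'k) mpoly" where
  "msubst \<phi> f =
    (\<Sum>m \<in> Poly_Mapping.keys f. mconst (Poly_Mapping.lookup f m) *
      (\<Prod>v \<in> Poly_Mapping.keys m. \<phi> v ^ Poly_Mapping.lookup m v))"

definition mrestrict :: "'v set \<Rightarrow> ('v, 'k::comm_ring_1) mpoly \<Rightarrow> ('v, 'k) mpoly" where
  "mrestrict A = msubst (\<lambda>v. if v \<in> A then mvar v else 0)"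

definition mono_degree :: "('v \<Rightarrow>\<^sub>0 nat) \<Rightarrow> nat" where
  "mono_degree m = (\<Sum>v \<in> Poly_Mapping.keys m. Poly_Mapping.lookup m v)"

definition homogeneous :: "nat \<Rightarrow> ('v, 'k::comm_ring_1) mpoly \<Rightarrow> bool" where
  "homogeneous n f \<longleftrightarrow> (\<forall>m \<in> Poly_Mapping.keys f. mono_degree m = n)"


section \<open>The Stanley-Reisner algebra\<close>

text \<open>The limit over \<open>P\<close> is realised as the set of compatible families, with pointwise operations.
  Families are extended by \<open>0\<close> outside \<open>carrier P\<close>.\<close>
definition stanley_reisner ::
    "('a, 'b) gorder_scheme \<Rightarrow> ('a \<Rightarrow> ('a, 'k::comm_ring_1) mpoly) set" where
  "stanley_reisner P =
    {F. (\<forall>p. p \<notin> carrier P \<longrightarrow> F p = 0) \<and>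
        (\<forall>p \<in> carrier P. F p \<in> mpolys_in (vertices_below P p)) \<and>
        (\<forall>p \<in> carrier P. \<forall>q \<in> carrier P. p \<sqsubseteq>\<^bsub>P\<^esub> q \<longrightarrow>
          mrestrict (vertices_below P p) (F q) = F p)}"

definition stanley_reisner_part ::
    "('a, 'b) gorder_scheme \<Rightarrow> nat \<Rightarrow> ('a \<Rightarrow> ('a, 'k::comm_ring_1) mpoly) set" where
  "stanley_reisner_part P n = {F \<in> stanley_reisner P. \<forall>p \<in> carrier P. homogeneous n (F p)}"

definition stanley_reisner_gen ::
    "('a, 'b) gorder_scheme \<Rightarrow> 'a \<Rightarrow> 'a \<Rightarrow> ('a, 'k::comm_ring_1) mpoly" where
  "stanley_reisner_gen P x =
    (\<lambda>y. if y \<in> carrier P \<and> x \<sqsubseteq>\<^bsub>P\<^esub> y then \<Prod>v \<in> vertices_below P x. mvar v else 0)"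


section \<open>Free graded modules and Poincare series\<close>

definition is_free_basis ::
    "('k::comm_ring_1 \<Rightarrow> 'b::ab_group_add \<Rightarrow> 'b) \<Rightarrow> 'b set \<Rightarrow> 'b set \<Rightarrow> bool" where
  "is_free_basis scale B M \<longleftrightarrow> \<not> module.dependent scale B \<and> module.span scale B = M"

definition free_finite_rank ::
    "('k::comm_ring_1 \<Rightarrow> 'b::ab_group_add \<Rightarrow> 'b) \<Rightarrow> 'b set \<Rightarrow> bool" where
  "free_finite_rank scale M \<longleftrightarrow> (\<exists>B. finite B \<and> is_free_basis scale B M)"

text \<open>Well-defined on free modules, since \<open>comm_ring_1\<close> includes \<open>0 \<noteq> 1\<close>.\<close>
definition free_rank ::
    "('k::comm_ring_1 \<Rightarrow> 'b::ab_group_add \<Rightarrow> 'b) \<Rightarrow> 'b set \<Rightarrow> nat" where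
  "free_rank scale M = (THE n. \<exists>B. finite B \<and> is_free_basis scale B M \<and> card B = n)"

text \<open>\<open>M n\<close> is the homogeneous part of degree \<open>n\<close>.\<close>
definition poincare_series ::
    "('k::comm_ring_1 \<Rightarrow> 'b::ab_group_add \<Rightarrow> 'b) \<Rightarrow> (nat \<Rightarrow> 'b set) \<Rightarrow> rat fps" where
  "poincare_series scale M = Abs_fps (\<lambda>n. of_nat (free_rank scale (M n)))"

definition family_scale ::
    "'k::comm_ring_1 \<Rightarrow> ('a \<Rightarrow> ('v, 'k) mpoly) \<Rightarrow> ('a \<Rightarrow> ('v, 'k) mpoly)" where
  "family_scale c F = (\<lambda>p. mconst c * F p)"

lemma module_family_scale:
  "module (family_scale :: 'k::comm_ring_1 \<Rightarrow> ('a \<Rightarrow> ('v, 'k) mpoly) \<Rightarrow> _)"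
proof standard
  fix a b :: 'k and F G :: "'a \<Rightarrow> ('v, 'k) mpoly"
  show "family_scale a (F + G) = family_scale a F + family_scale a G"
    by (simp add: family_scale_def fun_eq_iff distrib_left)
  show "family_scale (a + b) F = family_scale a F + family_scale b F"
    by (simp add: family_scale_def mconst_def fun_eq_iff single_add distrib_right)
  have "mconst (a * b) = (mconst a * mconst b :: ('v, 'k) mpoly)"
    by (simp add: mconst_def mult_single)
  then show "family_scale a (family_scale b F) = family_scale (a * b) F"
    by (simp add: family_scale_def mult.assoc)
  show "family_scale 1 F = F"
    by (simp add: family_scale_def mconst_def)
qed


section \<open>Consistency of the definitions\<close>

lemma prod_single_one:
  "finite A \<Longrightarrow> (\<Prod>v \<in> A. Poly_Mapping.single (h v) (1 :: 'k::comm_ring_1)) =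
    Poly_Mapping.single (\<Sum>v \<in> A. h v) 1"
  by (induction A rule: finite_induct) (auto simp: mult_single)

lemma mvar_power:
  "(mvar v :: ('v, 'k::comm_ring_1) mpoly) ^ n = Poly_Mapping.single (Poly_Mapping.single v n) 1"
  by (induction n) (auto simp: mvar_def mult_single simp flip: single_add)

lemma sum_singles:
  "(\<Sum>v \<in> Poly_Mapping.keys m. Poly_Mapping.single v (Poly_Mapping.lookup m v)) = m"
  by (rule poly_mapping_eqI) (simp add: lookup_sum lookup_single when_def in_keys_iff)

lemma lookup_mrestrict:
  fixes f :: "('v, 'k::comm_ring_1) mpoly"
  shows "Poly_Mapping.lookup (mrestrict A f) m =
    (if Poly_Mapping.keys m \<subseteq> A then Poly_Mapping.lookup f m else 0)"
proof -
  have term_eq: "mconst c * (\<Prod>v \<in> Poly_Mapping.keys l.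
      (if v \<in> A then mvar v else 0) ^ Poly_Mapping.lookup l v) =
      (if Poly_Mapping.keys l \<subseteq> A then Poly_Mapping.single l c else (0 :: ('v, 'k) mpoly))" for c l
  proof (cases "Poly_Mapping.keys l \<subseteq> A")
    case True
    then have "(\<Prod>v \<in> Poly_Mapping.keys l. (if v \<in> A then mvar v else 0) ^ Poly_Mapping.lookup l v) =
        (\<Prod>v \<in> Poly_Mapping.keys l.
          Poly_Mapping.single (Poly_Mapping.single v (Poly_Mapping.lookup l v)) (1 :: 'k))"
      by (intro prod.cong) (auto simp: mvar_power)
    then show ?thesis
      using True by (simp add: prod_single_one sum_singles mconst_def mult_single)
  next
    case False
    then obtain v where v: "v \<in> Poly_Mapping.keys l" "v \<notin> A" by auto
    then have "(\<Prod>v \<in> Poly_Mapping.keys l.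
        (if v \<in> A then mvar v else 0) ^ Poly_Mapping.lookup l v) = (0 :: ('v, 'k) mpoly)"
      by (intro prod_zero) (auto intro!: bexI[of _ v] simp: in_keys_iff power_0_left)
    then show ?thesis using False by simp
  qed
  show ?thesis
    by (auto simp: mrestrict_def msubst_def term_eq lookup_sum lookup_single when_def in_keys_iff
        if_distrib[of "\<lambda>f. Poly_Mapping.lookup f m"] sum.If_cases cong: if_cong
        intro!: sum.neutral)
qed

lemma mrestrict_mult: "mrestrict A (f * g) = mrestrict A f * mrestrict A g"
  for f g :: "('v, 'k::comm_ring_1) mpoly"
proof -
  have add: "mrestrict A (f + g) = mrestrict A f + mrestrict A g" for f g :: "('v, 'k) mpoly"
    by (rule poly_mapping_eqI) (simp add: lookup_mrestrict lookup_add)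
  have zero: "mrestrict A 0 = (0 :: ('v, 'k) mpoly)"
    by (rule poly_mapping_eqI) (simp add: lookup_mrestrict)
  have sum: "mrestrict A (sum h I) = (\<Sum>i \<in> I. mrestrict A (h i))"
    for h :: "('v \<Rightarrow>\<^sub>0 nat) \<Rightarrow> ('v, 'k) mpoly" and I
    by (induction I rule: infinite_finite_induct) (simp_all add: add zero)
  have single: "mrestrict A (Poly_Mapping.single m c) =
      (if Poly_Mapping.keys m \<subseteq> A then Poly_Mapping.single m c else 0)" for m and c :: 'k
    by (rule poly_mapping_eqI) (auto simp: lookup_mrestrict lookup_single when_def)
  have keys_add: "Poly_Mapping.keys (m + l) = Poly_Mapping.keys m \<union> Poly_Mapping.keys l"
    for m l :: "'v \<Rightarrow>\<^sub>0 nat"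
    by (auto simp: in_keys_iff lookup_add)
  have decomp: "(\<Sum>m \<in> Poly_Mapping.keys h. Poly_Mapping.single m (Poly_Mapping.lookup h m)) = h"
    for h :: "('v, 'k) mpoly"
    by (rule poly_mapping_eqI) (simp add: lookup_sum lookup_single when_def in_keys_iff)
  let ?s = "\<lambda>h m. Poly_Mapping.single m (Poly_Mapping.lookup h m) :: ('v, 'k) mpoly"
  have "mrestrict A ((\<Sum>m \<in> Poly_Mapping.keys f. ?s f m) * (\<Sum>l \<in> Poly_Mapping.keys g. ?s g l)) =
      mrestrict A (\<Sum>m \<in> Poly_Mapping.keys f. ?s f m) *
      mrestrict A (\<Sum>l \<in> Poly_Mapping.keys g. ?s g l)"
    unfolding sum_product sum
    by (intro sum.cong refl) (auto simp: mult_single single keys_add)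
  then show ?thesis by (simp only: decomp)
qed

lemma stanley_reisner_mult:
  fixes F G :: "'a \<Rightarrow> ('a, 'k::comm_ring_1) mpoly"
  assumes "F \<in> stanley_reisner P" "G \<in> stanley_reisner P"
  shows "F * G \<in> stanley_reisner P"
proof -
  have "f * g \<in> mpolys_in A" if "f \<in> mpolys_in A" "g \<in> mpolys_in A"
    for f g :: "('a, 'k) mpoly" and A
  proof -
    have "\<exists>l \<in> Poly_Mapping.keys f. \<exists>r \<in> Poly_Mapping.keys g. m = l + r"
      if "m \<in> Poly_Mapping.keys (f * g)" for m
      using that keys_mult[of f g] by blast
    then show ?thesis
      using that Poly_Mapping.keys_add by (fastforce simp: mpolys_in_def)
  qed
  then show ?thesis
    using assms by (auto simp: stanley_reisner_def mrestrict_mult)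
qed

lemma stanley_reisner_graded:
  fixes F :: "'a \<Rightarrow> ('a, 'k::comm_ring_1) mpoly"
  assumes F: "F \<in> stanley_reisner P" and fin: "finite (carrier P)"
  shows "\<exists>!G. (\<forall>n. G n \<in> stanley_reisner_part P n) \<and> finite {n. G n \<noteq> 0} \<and>
    F = (\<Sum>n | G n \<noteq> 0. G n)"
proof -
  define C where
    "C n p = Poly_Mapping.mapp (\<lambda>m c. if mono_degree m = n then c else 0) (F p)" for n p
  have lookup_C: "Poly_Mapping.lookup (C n p) m =
      (if mono_degree m = n then Poly_Mapping.lookup (F p) m else 0)" for n p m
    by (simp add: C_def lookup_mapp when_def in_keys_iff)
  have F0: "F p = 0" if "p \<notin> carrier P" for p
    using F that by (simp add: stanley_reisner_def)
  have C_part: "C n \<in> stanley_reisner_part P n" for n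
  proof -
    have "C n p = 0" if "p \<notin> carrier P" for p
      by (rule poly_mapping_eqI) (simp add: lookup_C F0 that)
    moreover have "C n p \<in> mpolys_in (vertices_below P p)" if "p \<in> carrier P" for p
    proof -
      have "F p \<in> mpolys_in (vertices_below P p)"
        using F that by (simp add: stanley_reisner_def)
      then show ?thesis
        by (auto simp: mpolys_in_def in_keys_iff lookup_C split: if_splits)
    qed
    moreover have "mrestrict (vertices_below P p) (C n q) = C n p"
      if "p \<in> carrier P" "q \<in> carrier P" "p \<sqsubseteq>\<^bsub>P\<^esub> q" for p q
    proof (rule poly_mapping_eqI)
      fix m
      have "mrestrict (vertices_below P p) (F q) = F p"
        using F that by (simp add: stanley_reisner_def)
      then show "Poly_Mapping.lookup (mrestrict (vertices_below P p) (C n q)) m =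
          Poly_Mapping.lookup (C n p) m"
        by (metis lookup_C lookup_mrestrict)
    qed
    moreover have "homogeneous n (C n p)" for p
      by (auto simp: homogeneous_def in_keys_iff lookup_C split: if_splits)
    ultimately show ?thesis
      by (simp add: stanley_reisner_part_def stanley_reisner_def)
  qed
  have fin_C: "finite {n. C n \<noteq> 0}"
  proof (rule finite_subset)
    show "{n. C n \<noteq> 0} \<subseteq> (\<Union>p \<in> carrier P. mono_degree ` Poly_Mapping.keys (F p))"
    proof
      fix n assume "n \<in> {n. C n \<noteq> 0}"
      then obtain p where "C n p \<noteq> 0" by (auto simp: fun_eq_iff)
      then obtain m where "Poly_Mapping.lookup (C n p) m \<noteq> 0"
        by (auto simp: poly_mapping_eq_iff fun_eq_iff)
      then have m: "mono_degree m = n" "Poly_Mapping.lookup (F p) m \<noteq> 0"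
        by (auto simp: lookup_C split: if_splits)
      then have "p \<in> carrier P" using F0 by force
      moreover have "m \<in> Poly_Mapping.keys (F p)" using m(2) by (simp add: in_keys_iff)
      ultimately show "n \<in> (\<Union>p \<in> carrier P. mono_degree ` Poly_Mapping.keys (F p))"
        using m(1) by blast
    qed
  qed (use fin in auto)
  have apply_sum: "(\<Sum>n \<in> N. G n) p = (\<Sum>n \<in> N. G n p)"
    for G :: "nat \<Rightarrow> 'a \<Rightarrow> ('a, 'k) mpoly" and N p
    by (induction N rule: infinite_finite_induct) simp_all
  have sum_C: "F = (\<Sum>n | C n \<noteq> 0. C n)"
  proof (rule ext, rule poly_mapping_eqI)
    fix p m
    have "(\<Sum>n | C n \<noteq> 0. Poly_Mapping.lookup (C n p) m) =
        (if C (mono_degree m) \<noteq> 0 then Poly_Mapping.lookup (F p) m else 0)"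
      using fin_C by (simp add: lookup_C)
    also have "\<dots> = Poly_Mapping.lookup (F p) m"
      using lookup_C[of "mono_degree m" p m] by auto
    finally show "Poly_Mapping.lookup (F p) m =
        Poly_Mapping.lookup ((\<Sum>n | C n \<noteq> 0. C n) p) m"
      by (simp add: apply_sum lookup_sum)
  qed
  show ?thesis
  proof (rule ex1I[of _ C])
    show "(\<forall>n. C n \<in> stanley_reisner_part P n) \<and> finite {n. C n \<noteq> 0} \<and>
        F = (\<Sum>n | C n \<noteq> 0. C n)"
      using C_part fin_C sum_C by blast
  next
    fix G :: "nat \<Rightarrow> 'a \<Rightarrow> ('a, 'k) mpoly"
    assume G: "(\<forall>n. G n \<in> stanley_reisner_part P n) \<and> finite {n. G n \<noteq> 0} \<and>
        F = (\<Sum>n | G n \<noteq> 0. G n)"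
    show "G = C"
    proof (rule ext, rule ext, rule poly_mapping_eqI)
      fix n p m
      have hom: "Poly_Mapping.lookup (G l p) m = 0" if "mono_degree m \<noteq> l" for l
      proof (cases "p \<in> carrier P")
        case True
        then have "homogeneous l (G l p)"
          using G by (simp add: stanley_reisner_part_def)
        then show ?thesis
          using that by (auto simp: homogeneous_def in_keys_iff)
      next
        case False
        then have "G l p = 0"
          using G by (simp add: stanley_reisner_part_def stanley_reisner_def)
        then show ?thesis by simp
      qed
      have "Poly_Mapping.lookup (F p) m = (\<Sum>l | G l \<noteq> 0. Poly_Mapping.lookup (G l p) m)"
        using G by (metis apply_sum lookup_sum)
      also have "\<dots> = (\<Sum>l | G l \<noteq> 0.
          if l = mono_degree m then Poly_Mapping.lookup (G (mono_degree m) p) m else 0)"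
        by (intro sum.cong) (auto simp: hom)
      also have "\<dots> = Poly_Mapping.lookup (G (mono_degree m) p) m"
        using G by auto
      finally show "Poly_Mapping.lookup (G n p) m = Poly_Mapping.lookup (C n p) m"
        using hom by (auto simp: lookup_C)
    qed
  qed
qed

lemma le_if_vertices_below_subset:
  assumes poly: "polyhedral_poset P" and reg: "regular_poset P"
    and car: "x \<in> carrier P" "p \<in> carrier P" "q \<in> carrier P"
    and le: "x \<sqsubseteq>\<^bsub>P\<^esub> q" "p \<sqsubseteq>\<^bsub>P\<^esub> q"
    and sub: "vertices_below P x \<subseteq> vertices_below P p"
  shows "x \<sqsubseteq>\<^bsub>P\<^esub> p"
proof -
  interpret polyhedral_poset P by (rule poly)
  interpret D: lower_semilattice "down P q" by (rule down_lower_semilattice) (rule car)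
  have "x \<in> carrier (down P q)" "p \<in> carrier (down P q)"
    using car le by (auto simp: down_def)
  then obtain w where w: "greatest (down P q) w (Lower (down P q) {x, p})"
    using D.inf_of_two_exists by blast
  then have w': "w \<in> carrier P" "w \<sqsubseteq>\<^bsub>P\<^esub> x" "w \<sqsubseteq>\<^bsub>P\<^esub> p"
    using car le by (auto simp: greatest_def Lower_def down_def)
  have "vertices_below P w = vertices_below P x"
  proof
    show "vertices_below P w \<subseteq> vertices_below P x"
      using w' car by (auto simp: vertices_below_def poset_vertices_def intro: le_trans)
    show "vertices_below P x \<subseteq> vertices_below P w"
    proof
      fix v assume v: "v \<in> vertices_below P x"
      then have v': "v \<in> carrier P" "v \<sqsubseteq>\<^bsub>P\<^esub> x" "v \<sqsubseteq>\<^bsub>P\<^esub> p" "v \<in> poset_vertices P"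
        using sub by (auto simp: vertices_below_def poset_vertices_def)
      then have "v \<sqsubseteq>\<^bsub>P\<^esub> q" using car le le_trans by blast
      then have "v \<in> Lower (down P q) {x, p}"
        using v' by (auto simp: Lower_def down_def)
      then show "v \<in> vertices_below P w"
        using w v' by (auto simp: greatest_def down_def vertices_below_def)
    qed
  qed
  then have "poset_isomorphic (down P w) (down P x)"
    using reg w' car by (simp add: regular_poset_def)
  then have "card (carrier (down P w)) = card (carrier (down P x))"
    by (auto simp: poset_isomorphic_def bij_betw_same_card)
  moreover have "carrier (down P w) \<subseteq> carrier (down P x)"
    using w' car by (auto simp: down_def intro: le_trans)
  moreover have "finite (carrier (down P x))"
    using finite_carrier by (simp add: down_def)
  ultimately have "carrier (down P w) = carrier (down P x)"
    by (simp add: card_subset_eq)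
  then have "x \<sqsubseteq>\<^bsub>P\<^esub> w"
    using car by (auto simp: down_def)
  then show ?thesis using w' car le_trans by blast
qed

text \<open>The grading is the one in which the generator of \<open>x\<close> has degree \<open>|V(x)|\<close>.\<close>
lemma stanley_reisner_gen_degree:
  assumes poly: "polyhedral_poset P" and reg: "regular_poset P" and x: "x \<in> carrier P"
  shows "(stanley_reisner_gen P x :: 'a \<Rightarrow> ('a, 'k::comm_ring_1) mpoly)
    \<in> stanley_reisner_part P (card (vertices_below P x))"
proof -
  interpret polyhedral_poset P by (rule poly)
  let ?V = "vertices_below P"
  define m where "m = (\<Sum>v \<in> ?V x. Poly_Mapping.single v (1 :: nat))"
  have fin: "finite (?V x)"
    by (rule finite_subset[OF _ finite_carrier])
      (auto simp: vertices_below_def poset_vertices_def)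
  have gen: "stanley_reisner_gen P x = (\<lambda>y. if y \<in> carrier P \<and> x \<sqsubseteq>\<^bsub>P\<^esub> y
      then Poly_Mapping.single m (1 :: 'k) else 0)"
    unfolding stanley_reisner_gen_def mvar_def m_def prod_single_one[OF fin] ..
  have lookup_m: "Poly_Mapping.lookup m v = (if v \<in> ?V x then 1 else 0)" for v
    using fin by (simp add: m_def lookup_sum lookup_single when_def)
  then have keys_m: "Poly_Mapping.keys m = ?V x"
    by (auto simp: in_keys_iff split: if_splits)
  have "mono_degree m = card (?V x)"
    unfolding mono_degree_def keys_m lookup_m by simp
  moreover have "?V x \<subseteq> ?V y" if "y \<in> carrier P" "x \<sqsubseteq>\<^bsub>P\<^esub> y" for y
    using that x by (auto simp: vertices_below_def poset_vertices_def intro: le_trans)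
  moreover have "mrestrict (?V p) (stanley_reisner_gen P x q) =
      (stanley_reisner_gen P x p :: ('a, 'k) mpoly)"
    if pq: "p \<in> carrier P" "q \<in> carrier P" "p \<sqsubseteq>\<^bsub>P\<^esub> q" for p q
  proof (cases "x \<sqsubseteq>\<^bsub>P\<^esub> q")
    case True
    have "?V x \<subseteq> ?V p \<longleftrightarrow> x \<sqsubseteq>\<^bsub>P\<^esub> p"
      using le_if_vertices_below_subset[OF poly reg x _ _ True] pq calculation(2) by blast
    then show ?thesis
      using True pq
      by (intro poly_mapping_eqI)
        (auto simp: gen lookup_mrestrict lookup_single when_def keys_m)
  next
    case False
    then have "\<not> x \<sqsubseteq>\<^bsub>P\<^esub> p" using pq x le_trans by blast
    then show ?thesis
      using False by (intro poly_mapping_eqI) (auto simp: gen lookup_mrestrict)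
  qed
  ultimately show ?thesis
    by (auto simp: stanley_reisner_part_def stanley_reisner_def homogeneous_def mpolys_in_def
        gen keys_m)
qed

end

theory Submission
  imports Defs "Jordan_Normal_Form.Determinant"
begin

text \<open>
  An element of the limit assigns a coefficient to every pair of an object \<open>p\<close> and a monomial \<open>m\<close>
  whose support lies in \<open>V(p)\<close> (\<open>p\<close> \<^emph>\<open>carries\<close> \<open>m\<close>), and compatibility says precisely that this
  coefficient does not change when \<open>p\<close> is replaced by some \<open>q \<ge> p\<close>. If \<open>p\<close> and \<open>p'\<close> have a common upper bound \<open>q\<close> and both
  carry \<open>m\<close>, then so does their meet in \<open>P\<^sub>\<le>\<^sub>q\<close>. Hence every pair \<open>(q, m)\<close> lies above exactly one
  minimal pair \<open>(p, m)\<close>, one for which no \<open>y < p\<close> carries \<open>m\<close>; we say that the support of \<open>m\<close> is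
  \<^emph>\<open>full\<close> in \<open>p\<close>. A family is therefore determined by arbitrary coefficients at the minimal pairs,
  and the families with a single coefficient \<open>1\<close> are a basis of each homogeneous part
  (\<open>monomial_family_basis\<close>). Any two finite bases have the same cardinality, by a determinant argument
  that works over every commutative ring (\<open>free_rank_eq_card\<close>), so the rank in degree \<open>n\<close> is the
  number of minimal pairs of degree \<open>n\<close>.

  The monomials with support exactly \<open>S\<close> have the generating function \<open>(t / (1 - t))\<^bsup>|S|\<^esup>\<close>
  (\<open>card_supported_monomials_fps\<close>), and so the Poincare series is the sum over \<open>j\<close> of
  \<open>a\<^sub>j (t / (1 - t))\<^sup>j\<close>, where \<open>a\<^sub>j\<close> is the number of pairs of an object \<open>p\<close> and a full subset of \<open>V(p)\<close>
  with \<open>j\<close> elements.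

  It remains to compute \<open>a\<^sub>j\<close>, with \<open>i = j - 1\<close> (\<open>card_full_subsets_eq\<close>, \<open>sum_card_full_subsets\<close>).
  An object with \<open>|V(p)| < j\<close> contributes nothing. If \<open>|V(p)| = j\<close>, the only candidate is \<open>V(p)\<close>
  itself, which is full because in a regular polyhedral poset \<open>V(p) \<subseteq> V(y)\<close> for \<open>y \<le> p\<close> forces
  \<open>y = p\<close>; these objects contribute \<open>f\<^sub>i\<close>. If \<open>|V(p)| = k + 1 > j\<close>, the number of full subsets is
  \<open>\<nu>\<^sub>i\<^sub>,\<^sub>k\<close>: for \<open>i \<ge> 1\<close> this is the definition, and the convention \<open>\<nu> = 0\<close> for \<open>i \<le> 0\<close> is correct as
  the empty set is full only in the least object and \<open>{v}\<close> only in \<open>v\<close>.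
\<close>

section \<open>Invariance of the rank over commutative rings\<close>

text \<open>Write each of the two sets in terms of the other. By independence of \<open>C\<close>, the coefficient matrices
  satisfy \<open>U W = 1\<close>, where \<open>U\<close> has \<open>card C\<close> rows and \<open>card B\<close> columns. If \<open>card B < card C\<close>, padding
  with zeros makes both matrices square, and then \<open>det U = 0\<close> contradicts \<open>det U * det W = 1\<close>.\<close>
lemma (in Modules.module) card_le_if_independent_in_span:
  assumes fin: "finite B" "finite C" and ind: "independent C"
    and sub: "C \<subseteq> span B" "B \<subseteq> span C"
  shows "card C \<le> card B"
proof (rule ccontr)
  define m n where "m = card B" and "n = card C"
  assume "\<not> card C \<le> card B"
  then have mn: "m < n" by (simp add: m_def n_def)
  obtain b where b: "bij_betw b {0..<m} B"
    using fin ex_bij_betw_nat_finite unfolding m_def by blast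
  obtain c where c: "bij_betw c {0..<n} C"
    using fin ex_bij_betw_nat_finite unfolding n_def by blast
  have "\<exists>u. \<forall>i<n. c i = (\<Sum>j = 0..<m. u i j *s b j)"
  proof -
    have "\<exists>u. c i = (\<Sum>j = 0..<m. u j *s b j)" if "i < n" for i
    proof -
      have "c i \<in> span B" using that c sub by (auto simp: bij_betw_def)
      then obtain w where "c i = (\<Sum>y\<in>B. w y *s y)"
        using span_finite[OF fin(1)] by auto
      also have "\<dots> = (\<Sum>j = 0..<m. w (b j) *s b j)"
        by (rule sum.reindex_bij_betw[OF b, symmetric])
      finally show ?thesis by (rule exI[of _ "\<lambda>j. w (b j)"])
    qed
    then show ?thesis by metis
  qed
  then obtain u where u: "\<And>i. i < n \<Longrightarrow> c i = (\<Sum>j = 0..<m. u i j *s b j)" by blast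
  have "\<exists>w. \<forall>j<m. b j = (\<Sum>l = 0..<n. w j l *s c l)"
  proof -
    have "\<exists>w. b j = (\<Sum>l = 0..<n. w l *s c l)" if "j < m" for j
    proof -
      have "b j \<in> span C" using that b sub by (auto simp: bij_betw_def)
      then obtain w where "b j = (\<Sum>y\<in>C. w y *s y)"
        using span_finite[OF fin(2)] by auto
      also have "\<dots> = (\<Sum>l = 0..<n. w (c l) *s c l)"
        by (rule sum.reindex_bij_betw[OF c, symmetric])
      finally show ?thesis by (rule exI[of _ "\<lambda>j. w (c j)"])
    qed
    then show ?thesis by metis
  qed
  then obtain w where w: "\<And>j. j < m \<Longrightarrow> b j = (\<Sum>l = 0..<n. w j l *s c l)" by blast
  have uw: "(\<Sum>j = 0..<m. u i j * w j l) = (if i = l then 1 else 0)" if "i < n" "l < n" for i l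
  proof -
    \<comment> \<open>The defect \<open>d\<close> gives a linear relation between the elements of \<open>C\<close>.\<close>
    define d where "d = (\<lambda>l. (\<Sum>j = 0..<m. u i j * w j l) - (if i = l then 1 else 0))"
    have "c i = (\<Sum>j = 0..<m. u i j *s (\<Sum>l = 0..<n. w j l *s c l))"
      using u[OF \<open>i < n\<close>] w by simp
    also have "\<dots> = (\<Sum>l = 0..<n. (\<Sum>j = 0..<m. u i j * w j l) *s c l)"
      by (simp add: scale_sum_right scale_sum_left sum.swap[of _ "{0..<n}"])
    finally have "(\<Sum>l = 0..<n. d l *s c l) = c i - (\<Sum>l = 0..<n. (if i = l then 1 else 0) *s c l)"
      by (simp add: d_def scale_left_diff_distrib sum_subtractf)
    also have "(\<Sum>l = 0..<n. (if i = l then 1 else 0) *s c l) = (\<Sum>l = 0..<n. if i = l then c l else 0)"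
      by (intro sum.cong) auto
    also have "\<dots> = c i"
      using \<open>i < n\<close> by simp
    finally have "(\<Sum>l = 0..<n. d l *s c l) = 0" by simp
    also have "(\<Sum>l = 0..<n. d l *s c l)
        = (\<Sum>l = 0..<n. d (the_inv_into {0..<n} c (c l)) *s c l)"
      using c by (intro sum.cong) (auto simp: bij_betw_def the_inv_into_f_f)
    also have "\<dots> = (\<Sum>y\<in>C. d (the_inv_into {0..<n} c y) *s y)"
      by (rule sum.reindex_bij_betw[OF c])
    finally have "d (the_inv_into {0..<n} c (c l)) = 0"
      using c \<open>l < n\<close>
      by (intro independentD[OF ind fin(2) subset_refl, of "\<lambda>y. d (the_inv_into {0..<n} c y)"])
        (auto simp: bij_betw_def)
    then show ?thesis
      using c \<open>l < n\<close> by (auto simp: bij_betw_def the_inv_into_f_f d_def split: if_splits)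
  qed
  define U where "U = mat n n (\<lambda>(i, j). if j < m then u i j else 0)"
  define W where "W = mat n n (\<lambda>(j, l). if j < m then w j l else 0)"
  have UW: "U \<in> carrier_mat n n" "W \<in> carrier_mat n n" by (auto simp: U_def W_def)
  have "U * W = 1\<^sub>m n"
  proof (rule eq_matI)
    fix i l assume "i < dim_row (1\<^sub>m n :: 'a mat)" "l < dim_col (1\<^sub>m n :: 'a mat)"
    then have il: "i < n" "l < n" by auto
    have "(U * W) $$ (i, l) = (\<Sum>j = 0..<n. if j < m then u i j * w j l else 0)"
      using il by (auto simp: U_def W_def scalar_prod_def intro!: sum.cong)
    also have "\<dots> = (\<Sum>j = 0..<m. u i j * w j l)"
      using mn by (intro sum.mono_neutral_cong_right) auto
    finally show "(U * W) $$ (i, l) = 1\<^sub>m n $$ (i, l)" using uw il by simp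
  qed (use UW in auto)
  then have "det U * det W = 1"
    using det_mult[OF UW] by simp
  moreover have "det U = 0"
  proof -
    \<comment> \<open>Column \<open>m\<close> exists because \<open>m < n\<close>, and it belongs to the padding.\<close>
    have "det U = (\<Sum>i<n. U $$ (i, m) * cofactor U i m)"
      by (rule laplace_expansion_column[OF UW(1) mn])
    also have "\<dots> = 0" using mn by (simp add: U_def)
    finally show ?thesis .
  qed
  ultimately show False by simp
qed

lemma (in Modules.module) free_rank_eq_card:
  assumes "finite B" "is_free_basis scale B M"
  shows "free_rank scale M = card B"
  unfolding free_rank_def
proof (rule the_equality)
  show "\<exists>C. finite C \<and> is_free_basis (*s) C M \<and> card C = card B" using assms by blast
next
  fix n assume "\<exists>C. finite C \<and> is_free_basis (*s) C M \<and> card C = n"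
  then obtain C where C: "finite C" "is_free_basis (*s) C M" "card C = n" by blast
  then have "card C \<le> card B" "card B \<le> card C"
    using assms span_superset unfolding is_free_basis_def
    by (auto intro!: card_le_if_independent_in_span)
  then show "n = card B" using C by simp
qed

section \<open>Monomials with prescribed support\<close>

definition supported_monomials :: "'v set \<Rightarrow> nat \<Rightarrow> ('v \<Rightarrow>\<^sub>0 nat) set" where
  "supported_monomials S n = {m. Poly_Mapping.keys m = S \<and> mono_degree m = n}"

text \<open>The exponent \<open>k\<close> of \<open>v\<close> must be positive, since \<open>v\<close> lies in the support.\<close>
lemma supported_monomials_insert:
  assumes "finite S" "v \<notin> S"
  shows "supported_monomials (insert v S) n =
    (\<Union>k\<in>{1..n}. (\<lambda>m. m + Poly_Mapping.single v k) ` supported_monomials S (n - k))" (is "?L = ?R")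
proof
  show "?L \<subseteq> ?R"
  proof
    fix m assume "m \<in> ?L"
    then have m: "Poly_Mapping.keys m = insert v S" "mono_degree m = n"
      by (auto simp: supported_monomials_def)
    define k where "k = Poly_Mapping.lookup m v"
    define m' where "m' = m - Poly_Mapping.single v k"
    have k: "k \<noteq> 0" using m in_keys_iff[of v m] by (simp add: k_def)
    have n: "n = k + (\<Sum>w\<in>S. Poly_Mapping.lookup m w)"
      using m assms by (simp add: mono_degree_def k_def)
    have lookup: "Poly_Mapping.lookup m' w = (if w = v then 0 else Poly_Mapping.lookup m w)" for w
      by (simp add: m'_def lookup_minus lookup_single when_def k_def)
    then have keys: "Poly_Mapping.keys m' = S"
      using m assms by (auto simp: in_keys_iff set_eq_iff)
    have "mono_degree m' = n - k"
      using assms by (auto simp: mono_degree_def keys lookup n intro!: sum.cong)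
    moreover have "m = m' + Poly_Mapping.single v k"
      by (rule poly_mapping_eqI) (simp add: lookup lookup_add lookup_single when_def k_def)
    ultimately show "m \<in> ?R"
      using k n keys by (auto simp: supported_monomials_def intro!: bexI[of _ k] image_eqI[of _ _ m'])
  qed
  show "?R \<subseteq> ?L"
  proof
    fix m assume "m \<in> ?R"
    then obtain k m' where k: "1 \<le> k" "k \<le> n" and m: "m = m' + Poly_Mapping.single v k"
      and m': "Poly_Mapping.keys m' = S" "mono_degree m' = n - k"
      by (auto simp: supported_monomials_def)
    have lookup: "Poly_Mapping.lookup m w = (if w = v then k else Poly_Mapping.lookup m' w)" for w
      using m' assms by (auto simp: m lookup_add lookup_single when_def in_keys_iff)
    then have keys: "Poly_Mapping.keys m = insert v S"
      using m' k by (auto simp: in_keys_iff set_eq_iff)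
    have "(\<Sum>w\<in>S. Poly_Mapping.lookup m w) = mono_degree m'"
      unfolding mono_degree_def m'(1) using assms by (intro sum.cong) (auto simp: lookup)
    then have "mono_degree m = n"
      using assms k m' by (simp add: mono_degree_def keys lookup[of v])
    then show "m \<in> ?L" using keys by (simp add: supported_monomials_def)
  qed
qed

lemma supported_monomials_empty: "supported_monomials {} n = (if n = 0 then {0} else {})"
  by (auto simp: supported_monomials_def mono_degree_def)

lemma finite_supported_monomials: "finite S \<Longrightarrow> finite (supported_monomials S n)"
  by (induction S arbitrary: n rule: finite_induct)
    (auto simp: supported_monomials_empty supported_monomials_insert)

lemma fps_X_over_one_minus_X:
  "fps_X / (1 - fps_X) = Abs_fps (\<lambda>n. if n = 0 then 0 else 1 :: rat)"
proof -
  have "(1 - fps_X) * Abs_fps (\<lambda>n. if n = 0 then 0 else 1) = (fps_X :: rat fps)"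
    by (rule fps_ext) (simp add: left_diff_distrib)
  then show ?thesis
    by (metis fps_mult_nth_0 fps_one_nth fps_sub_nth fps_X_nth diff_zero mult_zero_left
        nonzero_mult_div_cancel_left fps_zero_nth zero_neq_one)
qed

text \<open>Splitting off one variable with positive exponent is a convolution with the series
  \<open>t + t\<^sup>2 + t\<^sup>3 + \<dots> = t / (1 - t)\<close>.\<close>
lemma card_supported_monomials_fps:
  assumes "finite S"
  shows "Abs_fps (\<lambda>n. of_nat (card (supported_monomials S n))) =
    (fps_X / (1 - fps_X) :: rat fps) ^ card S"
  using assms
proof (induction S rule: finite_induct)
  case empty
  show ?case by (rule fps_ext) (simp add: supported_monomials_empty)
next
  case (insert v S)
  let ?M = "\<lambda>n. supported_monomials S n"
  show ?case
  proof (rule fps_ext)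
    fix n
    have disj: "((\<lambda>m. m + Poly_Mapping.single v k) ` ?M (n - k)) \<inter>
        ((\<lambda>m. m + Poly_Mapping.single v l) ` ?M (n - l)) = {}" if "k \<noteq> l" for k l
    proof -
      have "Poly_Mapping.lookup (m + Poly_Mapping.single v i) v = i" if "m \<in> ?M j" for m i j
        using that insert.hyps
        by (auto simp: supported_monomials_def lookup_add in_keys_iff)
      then show ?thesis using that by (metis (no_types, lifting) disjoint_iff imageE)
    qed
    have "card (supported_monomials (insert v S) n) =
        (\<Sum>k\<in>{1..n}. card ((\<lambda>m. m + Poly_Mapping.single v k) ` ?M (n - k)))"
      unfolding supported_monomials_insert[OF insert.hyps] using disj insert.hyps(1)
      by (intro card_UN_disjoint) (auto simp: finite_supported_monomials)
    also have "\<dots> = (\<Sum>k\<in>{1..n}. card (?M (n - k)))"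
      by (intro sum.cong card_image refl) (auto intro: inj_onI)
    finally have "of_nat (card (supported_monomials (insert v S) n)) =
        (\<Sum>k\<in>{1..n}. of_nat (card (?M (n - k))) :: rat)" by simp
    also have "\<dots> = (\<Sum>k = 0..n. (if k = 0 then 0 else 1) * of_nat (card (?M (n - k))))"
      by (intro sum.mono_neutral_cong_left) auto
    also have "\<dots> = fps_nth (fps_X / (1 - fps_X) * Abs_fps (\<lambda>n. of_nat (card (?M n)))) n"
      by (simp add: fps_X_over_one_minus_X fps_mult_nth)
    finally show "fps_nth (Abs_fps (\<lambda>n. of_nat (card (supported_monomials (insert v S) n)))) n =
        fps_nth ((fps_X / (1 - fps_X) :: rat fps) ^ card (insert v S)) n"
      using insert by simp
  qed
qed

section \<open>Minimal objects carrying a set of vertices\<close>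

text \<open>An object \<open>x\<close> carries \<open>S\<close> if \<open>S \<subseteq> V(x)\<close>. In a polyhedral poset, different objects in which the
  same set is full have no common upper bound, so below any object that carries \<open>S\<close> there
  is exactly one in which \<open>S\<close> is full.\<close>
definition full_subsets :: "('a, 'b) gorder_scheme \<Rightarrow> 'a \<Rightarrow> 'a set set" where
  "full_subsets P x = {S. S \<subseteq> vertices_below P x \<and>
    (\<forall>y \<in> carrier P. y \<sqsubset>\<^bsub>P\<^esub> x \<longrightarrow> \<not> S \<subseteq> vertices_below P y)}"

context polyhedral_poset
begin

lemma vertices_below_mono:
  "x \<in> carrier P \<Longrightarrow> y \<in> carrier P \<Longrightarrow> x \<sqsubseteq> y \<Longrightarrow> vertices_below P x \<subseteq> vertices_below P y"
  by (auto simp: vertices_below_def poset_vertices_def intro: le_trans)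

lemma finite_vertices_below: "finite (vertices_below P x)"
  by (rule finite_subset[OF _ finite_carrier]) (auto simp: vertices_below_def poset_vertices_def)

lemma finite_full_subsets: "finite (full_subsets P x)"
  by (rule finite_subset[of _ "Pow (vertices_below P x)"])
    (auto simp: full_subsets_def finite_vertices_below)

lemma finite_full_subset: "S \<in> full_subsets P x \<Longrightarrow> finite S"
  using finite_vertices_below finite_subset by (auto simp: full_subsets_def)

lemma full_subset_vertices_below: "S \<in> full_subsets P x \<Longrightarrow> S \<subseteq> vertices_below P x"
  by (simp add: full_subsets_def)

text \<open>The witness is the meet in \<open>P\<^sub>\<le>\<^sub>r\<close>: a vertex below both \<open>p\<close> and \<open>q\<close> is a lower bound of them
  there.\<close>
lemma meet_vertices_below:
  assumes car: "p \<in> carrier P" "q \<in> carrier P" "r \<in> carrier P" and le: "p \<sqsubseteq> r" "q \<sqsubseteq> r"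
  obtains w where "w \<in> carrier P" "w \<sqsubseteq> p" "w \<sqsubseteq> q"
    "vertices_below P p \<inter> vertices_below P q \<subseteq> vertices_below P w"
proof -
  interpret D: lower_semilattice "down P r" by (rule down_lower_semilattice) (rule car)
  have "p \<in> carrier (down P r)" "q \<in> carrier (down P r)"
    using car le by (auto simp: down_def)
  then obtain w where w: "greatest (down P r) w (Lower (down P r) {p, q})"
    using D.inf_of_two_exists by blast
  then have w': "w \<in> carrier P" "w \<sqsubseteq> p" "w \<sqsubseteq> q"
    using car le by (auto simp: greatest_def Lower_def down_def)
  have "v \<in> vertices_below P w" if "v \<in> vertices_below P p \<inter> vertices_below P q" for v
  proof -
    have v: "v \<in> carrier P" "v \<sqsubseteq> p" "v \<sqsubseteq> q" "v \<in> poset_vertices P"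
      using that by (auto simp: vertices_below_def poset_vertices_def)
    then have "v \<sqsubseteq> r" using car le le_trans by blast
    then have "v \<in> Lower (down P r) {p, q}"
      using v by (auto simp: Lower_def down_def)
    then show ?thesis
      using w v by (auto simp: greatest_def down_def vertices_below_def)
  qed
  then show thesis using that w' by blast
qed

text \<open>The meet of \<open>p\<close> and \<open>q\<close> still carries \<open>S\<close>, so by minimality of \<open>p\<close> it equals \<open>p\<close>.\<close>
lemma full_subset_least:
  assumes "S \<in> full_subsets P p" "S \<subseteq> vertices_below P q"
    and car: "p \<in> carrier P" "q \<in> carrier P" "r \<in> carrier P" and le: "p \<sqsubseteq> r" "q \<sqsubseteq> r"
  shows "p \<sqsubseteq> q"
proof -
  obtain w where w: "w \<in> carrier P" "w \<sqsubseteq> p" "w \<sqsubseteq> q"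
    "vertices_below P p \<inter> vertices_below P q \<subseteq> vertices_below P w"
    using meet_vertices_below[OF car le] .
  then have "S \<subseteq> vertices_below P w"
    using assms by (auto simp: full_subsets_def)
  then have "w = p"
    using assms w by (auto simp: full_subsets_def lless_eq)
  then show ?thesis using w by simp
qed

lemma full_subset_unique:
  assumes "S \<in> full_subsets P p" "S \<in> full_subsets P p'"
    and "p \<in> carrier P" "p' \<in> carrier P" "r \<in> carrier P" "p \<sqsubseteq> r" "p' \<sqsubseteq> r"
  shows "p = p'"
proof (rule le_antisym)
  show "p \<sqsubseteq> p'" using assms by (intro full_subset_least[of S p p' r] full_subset_vertices_below)
  show "p' \<sqsubseteq> p" using assms by (intro full_subset_least[of S p' p r] full_subset_vertices_below)
qed (use assms in auto)

lemma full_subset_exists: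
  assumes q: "q \<in> carrier P" "S \<subseteq> vertices_below P q"
  obtains p where "p \<in> carrier P" "p \<sqsubseteq> q" "S \<in> full_subsets P p"
proof -
  \<comment> \<open>Descend to an object with a smallest down-set among those that carry \<open>S\<close>.\<close>
  let ?Q = "\<lambda>p. p \<in> carrier P \<and> p \<sqsubseteq> q \<and> S \<subseteq> vertices_below P p"
  let ?size = "\<lambda>p. card {y \<in> carrier P. y \<sqsubseteq> p}"
  have "?Q q" using q by simp
  then obtain p where p: "?Q p" and least: "\<And>y. ?Q y \<Longrightarrow> ?size p \<le> ?size y"
    using ex_has_least_nat[of ?Q q ?size] by blast
  have "\<not> S \<subseteq> vertices_below P y" if y: "y \<in> carrier P" "y \<sqsubset> p" for y
  proof
    assume "S \<subseteq> vertices_below P y"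
    then have "?size p \<le> ?size y"
      using y p q le_trans[of y p q] by (intro least) (simp add: lless_eq)
    moreover have "{z \<in> carrier P. z \<sqsubseteq> y} \<subset> {z \<in> carrier P. z \<sqsubseteq> p}"
    proof (rule psubsetI)
      show "{z \<in> carrier P. z \<sqsubseteq> y} \<subseteq> {z \<in> carrier P. z \<sqsubseteq> p}"
        using y p by (auto simp: lless_eq intro: le_trans)
      have "\<not> p \<sqsubseteq> y" using y p le_antisym[of p y] by (auto simp: lless_eq)
      then show "{z \<in> carrier P. z \<sqsubseteq> y} \<noteq> {z \<in> carrier P. z \<sqsubseteq> p}"
        using p by (auto simp: set_eq_iff)
    qed
    then have "?size y < ?size p"
      using finite_carrier by (intro psubset_card_mono) auto
    ultimately show False by simp
  qed
  then show thesis using that p by (auto simp: full_subsets_def)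
qed

section \<open>Full subsets and the simplicial transform\<close>

lemma bottom_down:
  assumes "x \<in> carrier P"
  shows "\<bottom>\<^bsub>down P x\<^esub> = \<bottom>"
  unfolding bottom_def[of "down P x"]
proof (rule some_equality)
  show *: "least (down P x) \<bottom> (carrier (down P x))"
    using assms by (auto simp: least_def down_def bottom_lower)
  fix y assume "least (down P x) y (carrier (down P x))"
  then show "y = \<bottom>"
    using * by (auto simp: least_def down_def intro: le_antisym)
qed

lemma vertices_below_down:
  assumes "x \<in> carrier P" "y \<in> carrier P" "y \<sqsubseteq> x"
  shows "vertices_below (down P x) y = vertices_below P y"
proof -
  have car: "carrier (down P x) = {y \<in> carrier P. y \<sqsubseteq> x}"
    and le: "\<And>a b. a \<sqsubseteq>\<^bsub>down P x\<^esub> b \<longleftrightarrow> a \<sqsubseteq> b"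
    and less: "\<And>a b. a \<sqsubset>\<^bsub>down P x\<^esub> b \<longleftrightarrow> a \<sqsubset> b"
    by (auto simp: down_def lless_def)
  show ?thesis
    unfolding vertices_below_def poset_vertices_def car le less bottom_down[OF assms(1)]
    using assms by (auto intro: le_trans simp: lless_eq)
qed

text \<open>The relation that defines the simplicial transform never changes the vertex set of a pair. Hence
  the classes that contain a pair \<open>(x, S)\<close> correspond to the subsets \<open>S\<close> of \<open>V(x)\<close>.\<close>
lemma nu_at_eq_card_full_subsets:
  assumes x: "x \<in> carrier P"
  shows "nu_at P i x = card {S \<in> full_subsets P x. int (card S) = i + 1}"
proof -
  let ?R = "(transform_step (down P x))\<^sup>+"
  let ?class = "\<lambda>S. ?R `` {(x, S)}"
  have pairs: "(x, S) \<in> transform_pairs (down P x) \<longleftrightarrow> S \<subseteq> vertices_below P x" for S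
    using x by (simp add: transform_pairs_def vertices_below_down) (simp add: down_def)
  have "sym (transform_step (down P x))"
    by (auto simp: sym_def transform_step_def minimal_upper_bounds_def insert_commute)
  then have sym: "sym ?R" by (rule sym_trancl)
  have step: "snd a = snd b" "b \<in> transform_pairs (down P x)"
    if "(a, b) \<in> transform_step (down P x)" for a b
    using that by (auto simp: transform_step_def)
  have trancl_same: "snd a = snd b" if "(a, b) \<in> ?R" for a b
    using that by (induction rule: trancl.induct) (simp_all add: step(1))
  have same: "S = T" if "((y, S), (z, T)) \<in> ?R" for y z S T
    using trancl_same[OF that] by simp
  have refl: "(x, S) \<in> ?class S" if "S \<subseteq> vertices_below P x" for S
  proof -
    have "x \<in> minimal_upper_bounds (down P x) x x"
      using x by (auto simp: minimal_upper_bounds_def Upper_def down_def intro: le_antisym)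
    then have "((x, S), (x, S)) \<in> transform_step (down P x)"
      using that by (auto simp: transform_step_def pairs)
    then show ?thesis by auto
  qed
  have class_eq: "c = ?class S" if c: "c \<in> simplicial_transform (down P x)" "(x, S) \<in> c" for c S
  proof -
    obtain a where "c = ?R `` {a}"
      using c by (auto simp: simplicial_transform_def quotient_def)
    then have a: "(a, (x, S)) \<in> ?R" "((x, S), a) \<in> ?R"
      using c(2) symD[OF sym] by auto
    then have "(a, b) \<in> ?R \<longleftrightarrow> ((x, S), b) \<in> ?R" for b
      using trancl_trans by metis
    then show ?thesis using \<open>c = ?R `` {a}\<close> by auto
  qed
  have step_pairs: "b \<in> transform_pairs (down P x)" if "(a, b) \<in> ?R" for a b
    using that by (cases rule: trancl.cases) (simp_all add: step(2))
  have "{c \<in> simplicial_transform (down P x). \<exists>S. (x, S) \<in> c \<and> int (card S) = i + 1 \<and>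
        \<not> (\<exists>y \<in> carrier P. y \<sqsubset> x \<and> S \<subseteq> vertices_below P y)}
      = ?class ` {S \<in> full_subsets P x. int (card S) = i + 1}" (is "?L = ?r")
  proof (intro equalityI subsetI)
    fix c assume "c \<in> ?L"
    then obtain S where c: "c \<in> simplicial_transform (down P x)" "(x, S) \<in> c"
      and S: "int (card S) = i + 1" "\<not> (\<exists>y \<in> carrier P. y \<sqsubset> x \<and> S \<subseteq> vertices_below P y)"
      by blast
    have "c = ?class S" using c by (rule class_eq)
    moreover have "S \<subseteq> vertices_below P x"
      using c step_pairs by (auto simp: simplicial_transform_def quotient_def simp flip: pairs)
    ultimately show "c \<in> ?r" using S by (auto simp: full_subsets_def)
  next
    fix c assume "c \<in> ?r"
    then obtain S where S: "S \<in> full_subsets P x" "int (card S) = i + 1" and c: "c = ?class S"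
      by blast
    then have "(x, S) \<in> c" using refl by (simp add: full_subsets_def)
    moreover have "c \<in> simplicial_transform (down P x)"
      using S c pairs by (auto simp: simplicial_transform_def full_subsets_def intro: quotientI)
    ultimately show "c \<in> ?L" using S by (auto simp: full_subsets_def)
  qed
  moreover have "inj_on ?class {S \<in> full_subsets P x. int (card S) = i + 1}"
  proof (rule inj_onI)
    fix S T
    assume "T \<in> {S \<in> full_subsets P x. int (card S) = i + 1}" and eq: "?class S = ?class T"
    then have "(x, T) \<in> ?class S" using refl by (auto simp: full_subsets_def)
    then show "S = T" using same by blast
  qed
  ultimately show ?thesis by (simp add: nu_at_def card_image)
qed

text \<open>An isomorphism \<open>h\<close> preserves the least object, the top and the vertices, so \<open>S \<mapsto> h(S)\<close> maps full
  subsets of \<open>V(x)\<close> injectively to full subsets of \<open>V(y)\<close>. Under regularity the reverse inequality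
  comes from the isomorphism in the other direction.\<close>
lemma card_full_subsets_le_if_isomorphic:
  assumes iso: "poset_isomorphic (down P x) (down P y)" and car: "x \<in> carrier P" "y \<in> carrier P"
  shows "card {S \<in> full_subsets P x. card S = j} \<le> card {S \<in> full_subsets P y. card S = j}"
proof -
  have le: "\<And>a b z. a \<sqsubseteq>\<^bsub>down P z\<^esub> b \<longleftrightarrow> a \<sqsubseteq> b" by (simp add: down_def)
  obtain h where h: "bij_betw h (carrier (down P x)) (carrier (down P y))"
    and mono: "\<And>a b. a \<in> carrier (down P x) \<Longrightarrow> b \<in> carrier (down P x) \<Longrightarrow> a \<sqsubseteq> b \<longleftrightarrow> h a \<sqsubseteq> h b"
    using iso unfolding poset_isomorphic_def le by blast
  have downI: "\<And>a z. a \<in> carrier (down P z) \<longleftrightarrow> a \<in> carrier P \<and> a \<sqsubseteq> z" by (simp add: down_def)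
  have h_in: "h a \<in> carrier (down P y)" if "a \<in> carrier (down P x)" for a
    using h that by (auto simp: bij_betw_def)
  have h_inj: "h a = h b \<longleftrightarrow> a = b" if "a \<in> carrier (down P x)" "b \<in> carrier (down P x)" for a b
    using h that by (auto simp: bij_betw_def inj_on_def)
  have h_surj: "\<exists>a \<in> carrier (down P x). h a = b" if "b \<in> carrier (down P y)" for b
    using bij_betw_imp_surj_on[OF h] that by (metis imageE)
  have bot: "\<bottom> \<in> carrier (down P x)" "\<bottom> \<in> carrier (down P y)"
    using car by (auto simp: downI bottom_lower)
  have top: "x \<in> carrier (down P x)" "y \<in> carrier (down P y)"
    using car by (auto simp: downI)
  have h_bot: "h \<bottom> = \<bottom>"
  proof -
    obtain z where z: "z \<in> carrier (down P x)" "h z = \<bottom>" using h_surj[OF bot(2)] by blast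
    then have "h \<bottom> \<sqsubseteq> \<bottom>" using mono[of \<bottom> z] bot bottom_lower[of z] by (simp add: downI)
    then show ?thesis
      using h_in[OF bot(1)] bottom_lower[of "h \<bottom>"] le_antisym[of "h \<bottom>" \<bottom>]
      by (auto simp: downI)
  qed
  have h_top: "h x = y"
  proof -
    obtain z where z: "z \<in> carrier (down P x)" "h z = y" using h_surj[OF top(2)] by blast
    then have "y \<sqsubseteq> h x" using mono[of z x] top by (auto simp: downI)
    then show ?thesis
      using h_in[OF top(1)] le_antisym[of "h x" y] car by (simp add: downI)
  qed
  have V_down: "v \<in> carrier (down P z)" if "v \<in> vertices_below P z" for v z
    using that by (auto simp: vertices_below_def poset_vertices_def downI)
  have h_vertex: "h v \<in> vertices_below P y" if v: "v \<in> vertices_below P x" for v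
  proof -
    have vx: "v \<in> carrier (down P x)" using V_down[OF v] .
    have "w = \<bottom>" if w: "w \<in> carrier P" "w \<sqsubset> h v" for w
    proof -
      have "w \<in> carrier (down P y)"
        using w h_in[OF vx] car by (auto simp: downI lless_eq intro: le_trans)
      then obtain z where z: "z \<in> carrier (down P x)" "h z = w" using h_surj by blast
      then have "z \<sqsubset> v" using w vx mono[of z v] by (auto simp: lless_eq)
      then have "z = \<bottom>" using v z by (auto simp: vertices_below_def poset_vertices_def downI)
      then show ?thesis using z h_bot by simp
    qed
    moreover have "h v \<noteq> \<bottom>"
      using v vx bot h_bot h_inj[of v \<bottom>] by (auto simp: vertices_below_def poset_vertices_def)
    ultimately show ?thesis
      using h_in[OF vx] by (auto simp: vertices_below_def poset_vertices_def downI)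
  qed
  have sub: "S \<subseteq> carrier (down P x)" if "S \<in> full_subsets P x" for S
    using that V_down by (auto simp: full_subsets_def)
  have full: "h ` S \<in> full_subsets P y" if S: "S \<in> full_subsets P x" for S
  proof -
    have "\<not> h ` S \<subseteq> vertices_below P w" if w: "w \<in> carrier P" "w \<sqsubset> y" for w
    proof
      assume hS: "h ` S \<subseteq> vertices_below P w"
      have "w \<in> carrier (down P y)" using w by (auto simp: downI lless_eq)
      then obtain z where z: "z \<in> carrier (down P x)" "h z = w" using h_surj by blast
      then have zx: "z \<sqsubset> x" using w h_top by (auto simp: lless_eq downI)
      have "v \<in> vertices_below P z" if v: "v \<in> S" for v
      proof -
        have "h v \<sqsubseteq> h z" using hS v z by (auto simp: vertices_below_def)
        then have "v \<sqsubseteq> z" using mono sub[OF S] v z by blast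
        then show ?thesis using S v by (auto simp: full_subsets_def vertices_below_def)
      qed
      then show False using S z zx by (auto simp: full_subsets_def downI)
    qed
    then show ?thesis using S h_vertex by (auto simp: full_subsets_def)
  qed
  have inj: "inj_on h (carrier (down P x))" using h by (simp add: bij_betw_def)
  show ?thesis
  proof (rule card_inj_on_le)
    show "inj_on ((`) h) {S \<in> full_subsets P x. card S = j}"
      using sub inj by (intro inj_onI) (auto simp: inj_on_image_eq_iff)
    show "(`) h ` {S \<in> full_subsets P x. card S = j} \<subseteq> {S \<in> full_subsets P y. card S = j}"
      using full sub inj by (auto simp: card_image inj_on_subset)
    show "finite {S \<in> full_subsets P y. card S = j}" using finite_full_subsets by simp
  qed
qed

lemma full_subset_empty_iff:
  assumes x: "x \<in> carrier P"
  shows "{} \<in> full_subsets P x \<longleftrightarrow> x = \<bottom>"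
proof
  assume "{} \<in> full_subsets P x"
  then have "\<not> \<bottom> \<sqsubset> x" by (auto simp: full_subsets_def)
  then show "x = \<bottom>" using bottom_lower[OF x] by (simp add: lless_eq)
next
  assume "x = \<bottom>"
  then have "\<not> y \<sqsubset> x" if "y \<in> carrier P" for y
    using bottom_lower[OF that] le_antisym[of y \<bottom>] that by (auto simp: lless_eq)
  then show "{} \<in> full_subsets P x" by (auto simp: full_subsets_def)
qed

lemma vertices_below_bottom: "vertices_below P \<bottom> = {}"
proof -
  have "v = \<bottom>" if "v \<in> carrier P" "v \<sqsubseteq> \<bottom>" for v
    using that bottom_lower[of v] le_antisym[of v \<bottom>] by simp
  then show ?thesis by (auto simp: vertices_below_def poset_vertices_def)
qed

lemma vertices_below_vertex:
  assumes "v \<in> poset_vertices P"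
  shows "vertices_below P v = {v}"
  using assms by (auto simp: vertices_below_def poset_vertices_def lless_eq)

lemma full_subset_singleton:
  assumes x: "x \<in> carrier P" and v: "{v} \<in> full_subsets P x"
  shows "v = x \<and> vertices_below P x = {x}"
proof -
  have "v \<in> poset_vertices P" "v \<in> carrier P" "v \<sqsubseteq> x"
    using v by (auto simp: full_subsets_def vertices_below_def poset_vertices_def)
  then show ?thesis
    using v vertices_below_vertex[of v] by (auto simp: full_subsets_def lless_eq)
qed

text \<open>This justifies the convention that \<open>\<nu>\<^sub>i\<^sub>,\<^sub>k\<close> vanishes for \<open>i = -1\<close> and \<open>i = 0\<close>.\<close>
lemma card_full_subsets_small:
  assumes x: "x \<in> carrier P" and j: "j \<le> 1" "j < card (vertices_below P x)"
  shows "card {S \<in> full_subsets P x. card S = j} = 0"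
proof -
  have "card S \<noteq> j" if S: "S \<in> full_subsets P x" for S
  proof
    assume cS: "card S = j"
    consider "j = 0" | "j = 1" using j by linarith
    then show False
    proof cases
      case 1
      then have "S = {}" using cS finite_full_subset[OF S] by simp
      then show False
        using S x j full_subset_empty_iff vertices_below_bottom by auto
    next
      case 2
      then obtain v where "S = {v}" using cS card_1_singletonE by metis
      then show False using full_subset_singleton[OF x] S j 2 by auto
    qed
  qed
  then have "{S \<in> full_subsets P x. card S = j} = {}" by blast
  then show ?thesis by (simp only: card.empty)
qed

end

section \<open>Counting full subsets in regular polyhedral posets\<close>

locale regular_polyhedral_poset = polyhedral_poset +
  assumes regular: "regular_poset P"
begin

text \<open>If \<open>V(x) \<subseteq> V(y)\<close> with \<open>y < x\<close>, then \<open>P\<^sub>\<le>\<^sub>x\<close> and \<open>P\<^sub>\<le>\<^sub>y\<close> have equally many vertices and would be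
  isomorphic by regularity, although the second is a proper subset of the finite first.\<close>
lemma vertices_below_full:
  assumes x: "x \<in> carrier P"
  shows "vertices_below P x \<in> full_subsets P x"
proof -
  have "\<not> vertices_below P x \<subseteq> vertices_below P y" if y: "y \<in> carrier P" "y \<sqsubset> x" for y
  proof
    assume "vertices_below P x \<subseteq> vertices_below P y"
    then have "x \<sqsubseteq> y"
      using le_if_vertices_below_subset[OF polyhedral_poset_axioms regular x y(1) x] x y
      by (simp add: lless_eq)
    then show False using le_antisym[of x y] x y by (simp add: lless_eq)
  qed
  then show ?thesis by (simp add: full_subsets_def)
qed

lemma card_full_subsets_cong:
  assumes "x \<in> carrier P" "y \<in> carrier P"
    and "card (vertices_below P x) = card (vertices_below P y)"
  shows "card {S \<in> full_subsets P x. card S = j} = card {S \<in> full_subsets P y. card S = j}"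
proof (rule order_antisym)
  have "poset_isomorphic (down P x) (down P y)" "poset_isomorphic (down P y) (down P x)"
    using assms regular by (simp_all add: regular_poset_def)
  then show "card {S \<in> full_subsets P x. card S = j} \<le> card {S \<in> full_subsets P y. card S = j}"
    "card {S \<in> full_subsets P y. card S = j} \<le> card {S \<in> full_subsets P x. card S = j}"
    using assms by (simp_all only: card_full_subsets_le_if_isomorphic)
qed

text \<open>The index shifts come from \<open>\<nu>\<^sub>i\<^sub>,\<^sub>k\<close> counting sets of \<open>i + 1\<close> vertices in objects with \<open>k + 1\<close>
  vertices.\<close>
lemma card_full_subsets_eq:
  assumes x: "x \<in> carrier P"
  shows "card {S \<in> full_subsets P x. card S = j} =
    (if card (vertices_below P x) < j then 0
     else if card (vertices_below P x) = j then 1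
     else nu_num P (int j - 1) (int (card (vertices_below P x)) - 1))"
proof -
  let ?V = "vertices_below P x"
  have le: "card S \<le> card ?V" if "S \<in> full_subsets P x" for S
    using that by (intro card_mono finite_vertices_below full_subset_vertices_below)
  consider "card ?V < j" | "card ?V = j" | "j < card ?V" "j \<le> 1" | "j < card ?V" "j > 1"
    by linarith
  then show ?thesis
  proof cases
    case 1
    then have "{S \<in> full_subsets P x. card S = j} = {}" using le by fastforce
    then have "card {S \<in> full_subsets P x. card S = j} = 0" by (simp only: card.empty)
    then show ?thesis using 1 by simp
  next
    case 2
    have "S = ?V" if "S \<in> full_subsets P x" "card S = j" for S
      using 2 that by (intro card_subset_eq finite_vertices_below full_subset_vertices_below) auto
    then have "{S \<in> full_subsets P x. card S = j} = {?V}"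
      using 2 vertices_below_full[OF x] by blast
    then show ?thesis using 2 by simp
  next
    case 3
    then have "nu_num P (int j - 1) (int (card ?V) - 1) = 0" by (auto simp: nu_num_def)
    then show ?thesis using 3 card_full_subsets_small[OF x] by simp
  next
    case 4
    \<comment> \<open>The object that the choice operator in \<open>nu_num\<close> picks; by regularity \<open>x\<close> gives the same number.\<close>
    define y where "y = (SOME y. y \<in> carrier P \<and> int (card (vertices_below P y)) = int (card ?V))"
    have "y \<in> carrier P \<and> int (card (vertices_below P y)) = int (card ?V)"
      unfolding y_def by (rule someI[of _ x]) (use x in simp)
    then have y: "y \<in> carrier P" "card (vertices_below P y) = card ?V" by auto
    have "nu_num P (int j - 1) (int (card ?V) - 1) = nu_at P (int j - 1) y"
      using 4 by (simp add: nu_num_def y_def)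
    also have "\<dots> = card {S \<in> full_subsets P y. card S = j}"
      by (simp add: nu_at_eq_card_full_subsets y)
    also have "\<dots> = card {S \<in> full_subsets P x. card S = j}"
      by (rule card_full_subsets_cong[OF y(1) x y(2)])
    finally show ?thesis using 4 by simp
  qed
qed

lemma vertices_below_empty_iff:
  assumes x: "x \<in> carrier P"
  shows "vertices_below P x = {} \<longleftrightarrow> x = \<bottom>"
  using vertices_below_full[OF x] full_subset_empty_iff[OF x] vertices_below_bottom by auto

text \<open>For \<open>j = 0\<close> the value \<open>f\<^sub>-\<^sub>1 = 1\<close> is set by convention; it is the true count because only the
  least object has no vertices below it.\<close>
lemma card_vertices_below_eq_f_num:
  "card {x \<in> carrier P. card (vertices_below P x) = j} = f_num P (int j - 1)"
proof (cases "j = 0")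
  case True
  then have "{x \<in> carrier P. card (vertices_below P x) = j} = {\<bottom>}"
    using vertices_below_empty_iff finite_vertices_below bottom_closed by auto
  then show ?thesis using True by (simp add: f_num_def)
qed (simp add: f_num_def)

lemma sum_card_full_subsets:
  "(\<Sum>x\<in>carrier P. card {S \<in> full_subsets P x. card S = j}) =
    f_num P (int j - 1) + (\<Sum>k = int j..poset_norm P. f_num P k * nu_num P (int j - 1) k)"
proof -
  let ?c = "\<lambda>x. card (vertices_below P x)"
  let ?nu = "\<lambda>x. nu_num P (int j - 1) (int (?c x) - 1)"
  let ?big = "{x \<in> carrier P. j < ?c x}"
  have "(\<Sum>x\<in>carrier P. card {S \<in> full_subsets P x. card S = j}) =
      (\<Sum>x\<in>carrier P. (if ?c x = j then 1 else 0) + (if j < ?c x then ?nu x else 0))"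
    by (intro sum.cong HOL.refl) (auto simp: card_full_subsets_eq)
  also have "\<dots> = card {x \<in> carrier P. ?c x = j} + (\<Sum>x\<in>?big. ?nu x)"
    using finite_carrier by (simp add: sum.distrib sum.If_cases Int_def)
  also have "(\<Sum>x\<in>?big. ?nu x) = (\<Sum>k = int j..poset_norm P. f_num P k * nu_num P (int j - 1) k)"
  proof -
    have "?c x \<le> Max (?c ` carrier P)" if "x \<in> carrier P" for x
      using finite_carrier that by (intro Max_ge) auto
    then have "(\<lambda>x. int (?c x) - 1) ` ?big \<subseteq> {int j..poset_norm P}"
      by (fastforce simp: poset_norm_def)
    then have "(\<Sum>x\<in>?big. ?nu x) =
        (\<Sum>k = int j..poset_norm P. \<Sum>x\<in>{x \<in> ?big. int (?c x) - 1 = k}. ?nu x)"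
      using finite_carrier by (intro sum.group[symmetric]) auto
    also have "\<dots> = (\<Sum>k = int j..poset_norm P. f_num P k * nu_num P (int j - 1) k)"
    proof (rule sum.cong[OF HOL.refl])
      fix k assume k: "k \<in> {int j..poset_norm P}"
      then have "{x \<in> ?big. int (?c x) - 1 = k} = {x \<in> carrier P. int (?c x) = k + 1}"
        by auto
      moreover have "card {x \<in> carrier P. int (?c x) = k + 1} = f_num P k"
        using k by (auto simp: f_num_def)
      ultimately show "(\<Sum>x\<in>{x \<in> ?big. int (?c x) - 1 = k}. ?nu x) =
          f_num P k * nu_num P (int j - 1) k"
        by simp
    qed
    finally show ?thesis .
  qed
  finally show ?thesis by (simp add: card_vertices_below_eq_f_num)
qed

end

section \<open>A monomial basis of the Stanley-Reisner algebra\<close>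

lemma lookup_family_scale:
  "Poly_Mapping.lookup (family_scale c F p) m = c * Poly_Mapping.lookup (F p) m"
proof -
  have "mconst c * F p = Poly_Mapping.map ((*) c) (F p)"
    unfolding mconst_def by (rule mult_map_scale_conv_mult[symmetric])
  then show ?thesis
    by (simp add: family_scale_def Poly_Mapping.map.rep_eq when_def)
qed

lemma lookup_sum_fun:
  fixes G :: "'i \<Rightarrow> 'p \<Rightarrow> ('v, 'k::comm_ring_1) mpoly"
  shows "Poly_Mapping.lookup ((\<Sum>i\<in>I. G i) p) m = (\<Sum>i\<in>I. Poly_Mapping.lookup (G i p) m)"
  by (induction I rule: infinite_finite_induct) (simp_all add: lookup_add)

text \<open>The minimal pairs of degree \<open>n\<close>, which index the basis.\<close>
definition full_monomials :: "('a, 'b) gorder_scheme \<Rightarrow> nat \<Rightarrow> ('a \<times> ('a \<Rightarrow>\<^sub>0 nat)) set" where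
  "full_monomials P n =
    (SIGMA p:carrier P. \<Union>S\<in>full_subsets P p. supported_monomials S n)"

definition monomial_family ::
    "('a, 'b) gorder_scheme \<Rightarrow> 'a \<times> ('a \<Rightarrow>\<^sub>0 nat) \<Rightarrow> 'a \<Rightarrow> ('a, 'k::comm_ring_1) mpoly" where
  "monomial_family P = (\<lambda>(p, m) q.
    if q \<in> carrier P \<and> p \<sqsubseteq>\<^bsub>P\<^esub> q then Poly_Mapping.single m 1 else 0)"

lemma lookup_monomial_family:
  "Poly_Mapping.lookup (monomial_family P (p, m) q) m' =
    (if q \<in> carrier P \<and> p \<sqsubseteq>\<^bsub>P\<^esub> q \<and> m' = m then 1 else 0)"
  by (simp add: monomial_family_def lookup_single when_def)

lemma mem_full_monomials_iff:
  "(p, m) \<in> full_monomials P n \<longleftrightarrow>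
    p \<in> carrier P \<and> Poly_Mapping.keys m \<in> full_subsets P p \<and> mono_degree m = n"
  by (auto simp: full_monomials_def supported_monomials_def)

lemma lookup_stanley_reisner_mono:
  assumes "F \<in> stanley_reisner P" "p \<in> carrier P" "q \<in> carrier P" "p \<sqsubseteq>\<^bsub>P\<^esub> q"
    and "Poly_Mapping.keys m \<subseteq> vertices_below P p"
  shows "Poly_Mapping.lookup (F q) m = Poly_Mapping.lookup (F p) m"
proof -
  have "mrestrict (vertices_below P p) (F q) = F p"
    using assms by (simp add: stanley_reisner_def)
  then show ?thesis using assms(5) lookup_mrestrict[of "vertices_below P p" "F q" m] by simp
qed

lemma subspace_stanley_reisner_part:
  "Modules.module.subspace family_scale
    (stanley_reisner_part P n :: ('a \<Rightarrow> ('a, 'k::comm_ring_1) mpoly) set)"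
proof -
  interpret M: Modules.module "family_scale :: 'k \<Rightarrow> ('a \<Rightarrow> ('a, 'k) mpoly) \<Rightarrow> _"
    by (rule module_family_scale)
  have restrict: "mrestrict A (F + G) = mrestrict A F + mrestrict A G"
    "mrestrict A (mconst c * F) = mconst c * mrestrict A F"
    for A and c :: 'k and F G :: "('a, 'k) mpoly"
  proof -
    show "mrestrict A (F + G) = mrestrict A F + mrestrict A G"
      by (rule poly_mapping_eqI) (simp add: lookup_mrestrict lookup_add)
    show "mrestrict A (mconst c * F) = mconst c * mrestrict A F"
      using lookup_family_scale[of c "\<lambda>_. F"] lookup_family_scale[of c "\<lambda>_. mrestrict A F"]
      by (intro poly_mapping_eqI) (simp add: lookup_mrestrict family_scale_def)
  qed
  have scale: "Poly_Mapping.keys (mconst c * F) \<subseteq> Poly_Mapping.keys F"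
    for c :: 'k and F :: "('a, 'k) mpoly"
    using lookup_family_scale[of c "\<lambda>_. F"] by (auto simp: in_keys_iff family_scale_def)
  have zero: "mrestrict A 0 = (0 :: ('a, 'k) mpoly)" for A
    by (rule poly_mapping_eqI) (simp add: lookup_mrestrict)
  note keys_add = Poly_Mapping.keys_add[where ?'b = 'k]
  show ?thesis
    unfolding M.subspace_def
  proof (intro conjI allI ballI)
    show "(0 :: 'a \<Rightarrow> ('a, 'k) mpoly) \<in> stanley_reisner_part P n"
      by (simp add: stanley_reisner_part_def stanley_reisner_def mpolys_in_def homogeneous_def zero)
  next
    fix F G :: "'a \<Rightarrow> ('a, 'k) mpoly"
    assume "F \<in> stanley_reisner_part P n" "G \<in> stanley_reisner_part P n"
    then show "F + G \<in> stanley_reisner_part P n"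
      using keys_add by (fastforce simp: stanley_reisner_part_def stanley_reisner_def
          mpolys_in_def homogeneous_def restrict)
  next
    fix c :: 'k and F :: "'a \<Rightarrow> ('a, 'k) mpoly"
    assume "F \<in> stanley_reisner_part P n"
    then show "family_scale c F \<in> stanley_reisner_part P n"
      using scale by (fastforce simp: stanley_reisner_part_def stanley_reisner_def
          mpolys_in_def homogeneous_def restrict family_scale_def)
  qed
qed

context polyhedral_poset
begin

lemma finite_full_monomials: "finite (full_monomials P n)"
  unfolding full_monomials_def
  by (intro finite_SigmaI finite_carrier finite_UN_I finite_full_subsets
      finite_supported_monomials finite_full_subset)

text \<open>Compatibility along \<open>q \<le> r\<close> amounts to the equivalence \<open>le_iff\<close> in the proof: if \<open>p \<le> r\<close>, the
  restriction to \<open>V(q)\<close> keeps \<open>m\<close> exactly if \<open>p \<le> q\<close>. One direction is the fact that \<open>p\<close> is least among the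
  objects below \<open>r\<close> that carry \<open>m\<close>.\<close>
lemma monomial_family_mem:
  assumes pm: "(p, m) \<in> full_monomials P n"
  shows "(monomial_family P (p, m) :: 'a \<Rightarrow> ('a, 'k::comm_ring_1) mpoly) \<in> stanley_reisner_part P n"
    (is "?E \<in> _")
proof -
  have p: "p \<in> carrier P" and S: "Poly_Mapping.keys m \<in> full_subsets P p" and n: "mono_degree m = n"
    using pm by (auto simp: mem_full_monomials_iff)
  have keys: "l = m \<and> p \<sqsubseteq> q \<and> q \<in> carrier P" if "l \<in> Poly_Mapping.keys (?E q)" for l q
    using that by (simp add: in_keys_iff lookup_monomial_family split: if_splits)
  have le_iff: "p \<sqsubseteq> q \<longleftrightarrow> p \<sqsubseteq> r \<and> Poly_Mapping.keys m \<subseteq> vertices_below P q"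
    if "q \<in> carrier P" "r \<in> carrier P" "q \<sqsubseteq> r" for q r
  proof
    assume "p \<sqsubseteq> q"
    then show "p \<sqsubseteq> r \<and> Poly_Mapping.keys m \<subseteq> vertices_below P q"
      using le_trans[of p q r] vertices_below_mono[of p q] full_subset_vertices_below[OF S] p that
      by auto
  next
    assume "p \<sqsubseteq> r \<and> Poly_Mapping.keys m \<subseteq> vertices_below P q"
    then show "p \<sqsubseteq> q" using full_subset_least[OF S _ p that(1,2)] that by blast
  qed
  have "?E q \<in> mpolys_in (vertices_below P q)" if "q \<in> carrier P" for q
    using keys le_iff[OF that that] that by (auto simp: mpolys_in_def)
  moreover have "mrestrict (vertices_below P q) (?E r) = ?E q"
    if "q \<in> carrier P" "r \<in> carrier P" "q \<sqsubseteq> r" for q r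
    using le_iff[OF that] that
    by (intro poly_mapping_eqI) (auto simp: lookup_mrestrict lookup_monomial_family)
  moreover have "?E q = 0" if "q \<notin> carrier P" for q
    using that by (simp add: monomial_family_def)
  moreover have "homogeneous n (?E q)" for q
    using keys n by (auto simp: homogeneous_def)
  ultimately show ?thesis by (simp add: stanley_reisner_part_def stanley_reisner_def)
qed

text \<open>Compare coefficients at \<open>(q, m)\<close>. If \<open>m\<close> has degree \<open>n\<close> and \<open>q\<close> carries \<open>m\<close>, exactly one minimal
  pair \<open>(p, m)\<close> has \<open>p \<le> q\<close>, and \<open>F\<close> has the same coefficient there; otherwise both sides vanish.\<close>
lemma stanley_reisner_part_expansion:
  fixes F :: "'a \<Rightarrow> ('a, 'k::comm_ring_1) mpoly"
  assumes F: "F \<in> stanley_reisner_part P n"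
  shows "F = (\<Sum>(p, m)\<in>full_monomials P n.
    family_scale (Poly_Mapping.lookup (F p) m) (monomial_family P (p, m)))" (is "F = ?G")
proof (rule ext, rule poly_mapping_eqI)
  fix q m
  have FSR: "F \<in> stanley_reisner P" using F by (simp add: stanley_reisner_part_def)
  let ?c = "\<lambda>p. if q \<in> carrier P \<and> p \<sqsubseteq> q then Poly_Mapping.lookup (F p) m else 0"
  have "Poly_Mapping.lookup (?G q) m =
      (\<Sum>(p, l)\<in>full_monomials P n. if l = m then ?c p else 0)"
    unfolding lookup_sum_fun
    by (intro sum.cong HOL.refl) (auto simp: lookup_family_scale lookup_monomial_family)
  also have "\<dots> = Poly_Mapping.lookup (F q) m"
  proof (cases "q \<in> carrier P \<and> Poly_Mapping.keys m \<subseteq> vertices_below P q \<and> mono_degree m = n")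
    case True
    then obtain p where p: "p \<in> carrier P" "p \<sqsubseteq> q" "Poly_Mapping.keys m \<in> full_subsets P p"
      using full_subset_exists by blast
    have "(\<Sum>(p, l)\<in>full_monomials P n. if l = m then ?c p else 0) =
        (\<Sum>(p, l)\<in>{(p, m)}. if l = m then ?c p else 0)"
    proof (rule sum.mono_neutral_right[OF finite_full_monomials])
      show "{(p, m)} \<subseteq> full_monomials P n"
        using p True by (simp add: mem_full_monomials_iff)
      have "p' = p" if "(p', m) \<in> full_monomials P n" "p' \<sqsubseteq> q" for p'
        using that p True full_subset_unique[of "Poly_Mapping.keys m" p' p q]
        by (auto simp: mem_full_monomials_iff)
      then show "\<forall>i \<in> full_monomials P n - {(p, m)}. (case i of (p, l) \<Rightarrow> if l = m then ?c p else 0) = 0"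
        by (auto split: if_splits)
    qed
    also have "\<dots> = Poly_Mapping.lookup (F p) m" using True p by simp
    also have "\<dots> = Poly_Mapping.lookup (F q) m"
      using lookup_stanley_reisner_mono[OF FSR p(1) _ p(2)] full_subset_vertices_below[OF p(3)] True
      by simp
    finally show ?thesis .
  next
    case False
    have "Poly_Mapping.lookup (F q) m = 0"
    proof (cases "q \<in> carrier P")
      case True
      then have "F q \<in> mpolys_in (vertices_below P q)" "homogeneous n (F q)"
        using F by (auto simp: stanley_reisner_part_def stanley_reisner_def)
      then show ?thesis
        using False True by (auto simp: mpolys_in_def homogeneous_def in_keys_iff)
    next
      case False
      then show ?thesis using FSR by (simp add: stanley_reisner_def)
    qed
    moreover have "\<not> (q \<in> carrier P \<and> p \<sqsubseteq> q)" if "(p, m) \<in> full_monomials P n" for p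
      using that False vertices_below_mono[of p q] full_subset_vertices_below
      by (fastforce simp: mem_full_monomials_iff)
    then have "(\<Sum>(p, l)\<in>full_monomials P n. if l = m then ?c p else 0) = 0"
      by (intro sum.neutral) auto
    ultimately show ?thesis by simp
  qed
  finally show "Poly_Mapping.lookup (F q) m = Poly_Mapping.lookup (?G q) m" by simp
qed

text \<open>Evaluation at a minimal pair isolates its own coefficient, since no other minimal pair with the same
  monomial lies below it. This gives linear independence.\<close>
lemma monomial_family_coeff:
  fixes u :: "'a \<times> ('a \<Rightarrow>\<^sub>0 nat) \<Rightarrow> 'k::comm_ring_1"
  assumes pm: "(p, m) \<in> full_monomials P n"
  shows "Poly_Mapping.lookup
    ((\<Sum>i\<in>full_monomials P n. family_scale (u i) (monomial_family P i)) p) m = u (p, m)"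
proof -
  have eq: "i = (p, m)"
    if "i \<in> full_monomials P n" "fst i \<sqsubseteq> p" "snd i = m" for i
    using that pm full_subset_unique[of "Poly_Mapping.keys m" "fst i" p p]
    by (cases i) (auto simp: mem_full_monomials_iff)
  have "Poly_Mapping.lookup
      ((\<Sum>i\<in>full_monomials P n. family_scale (u i) (monomial_family P i)) p) m =
      (\<Sum>i\<in>full_monomials P n. if i = (p, m) then u i else 0)"
    unfolding lookup_sum_fun
  proof (intro sum.cong HOL.refl)
    fix i assume i: "i \<in> full_monomials P n"
    show "Poly_Mapping.lookup (family_scale (u i) (monomial_family P i) p) m =
        (if i = (p, m) then u i else 0)"
      using eq[OF i] pm
      by (cases i) (auto simp: lookup_family_scale lookup_monomial_family mem_full_monomials_iff)
  qed
  also have "\<dots> = u (p, m)" using pm finite_full_monomials by simp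
  finally show ?thesis .
qed

lemma monomial_family_basis:
  fixes n :: nat
  defines "B \<equiv> (monomial_family P :: _ \<Rightarrow> 'a \<Rightarrow> ('a, 'k::comm_ring_1) mpoly) ` full_monomials P n"
  shows "is_free_basis family_scale B (stanley_reisner_part P n)"
    and "card B = card (full_monomials P n)"
proof -
  interpret M: Modules.module "family_scale :: 'k \<Rightarrow> ('a \<Rightarrow> ('a, 'k) mpoly) \<Rightarrow> _"
    by (rule module_family_scale)
  let ?E = "monomial_family P :: _ \<Rightarrow> 'a \<Rightarrow> ('a, 'k) mpoly"
  have self: "Poly_Mapping.lookup (?E i (fst i)) (snd i) = 1" if "i \<in> full_monomials P n" for i
    using that by (cases i) (auto simp: lookup_monomial_family mem_full_monomials_iff)
  have inj: "inj_on ?E (full_monomials P n)"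
  proof (rule inj_onI)
    fix i j assume ij: "i \<in> full_monomials P n" "j \<in> full_monomials P n" and eq: "?E i = ?E j"
    have "Poly_Mapping.lookup (?E j (fst i)) (snd i) = 1" "Poly_Mapping.lookup (?E i (fst j)) (snd j) = 1"
      using self[OF ij(1)] self[OF ij(2)] eq by simp_all
    then have "fst j \<sqsubseteq> fst i" "fst i \<sqsubseteq> fst j" "snd i = snd j"
      by (cases i; cases j; simp add: lookup_monomial_family split: if_splits)+
    then show "i = j"
      using ij le_antisym[of "fst i" "fst j"] by (cases i; cases j) (simp add: mem_full_monomials_iff)
  qed
  then show "card B = card (full_monomials P n)" by (simp add: B_def card_image)
  have finB: "finite B" using finite_full_monomials by (simp add: B_def)
  have "u b = 0" if u: "(\<Sum>b\<in>B. family_scale (u b) b) = 0" and b: "b \<in> B" for u b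
  proof -
    obtain p m where pm: "(p, m) \<in> full_monomials P n" "b = ?E (p, m)"
      using b by (auto simp: B_def)
    have "(\<Sum>i\<in>full_monomials P n. family_scale (u (?E i)) (?E i)) = 0"
      using u inj by (simp add: B_def sum.reindex)
    then show ?thesis
      using monomial_family_coeff[OF pm(1), of "\<lambda>i. u (?E i)"] pm(2) by simp
  qed
  then have "M.independent B"
    unfolding M.dependent_finite[OF finB] by blast
  moreover have "M.span B = stanley_reisner_part P n"
  proof (rule M.span_subspace)
    show "B \<subseteq> stanley_reisner_part P n"
      using monomial_family_mem by (auto simp: B_def)
    show "stanley_reisner_part P n \<subseteq> M.span B"
    proof
      fix F :: "'a \<Rightarrow> ('a, 'k) mpoly" assume F: "F \<in> stanley_reisner_part P n"
      have "(\<Sum>(p, m)\<in>full_monomials P n. family_scale (Poly_Mapping.lookup (F p) m) (?E (p, m)))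
          \<in> M.span B"
        unfolding case_prod_beta by (intro M.span_sum M.span_scale M.span_base) (simp add: B_def)
      then show "F \<in> M.span B" using stanley_reisner_part_expansion[OF F] by simp
    qed
    show "M.subspace (stanley_reisner_part P n)" by (rule subspace_stanley_reisner_part)
  qed
  ultimately show "is_free_basis family_scale B (stanley_reisner_part P n)"
    by (simp add: is_free_basis_def)
qed

lemma stanley_reisner_part_free:
  "free_finite_rank family_scale (stanley_reisner_part P n :: ('a \<Rightarrow> ('a, 'k::comm_ring_1) mpoly) set)"
  using monomial_family_basis(1) finite_full_monomials
  unfolding free_finite_rank_def by blast

lemma free_rank_stanley_reisner_part:
  "free_rank family_scale (stanley_reisner_part P n :: ('a \<Rightarrow> ('a, 'k::comm_ring_1) mpoly) set)
    = card (full_monomials P n)"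
  using module.free_rank_eq_card[OF module_family_scale _ monomial_family_basis(1)]
    monomial_family_basis(2) finite_full_monomials
  by (metis finite_imageI)

lemma poincare_series_eq_sum:
  "poincare_series family_scale
      (stanley_reisner_part P :: nat \<Rightarrow> ('a \<Rightarrow> ('a, 'k::comm_ring_1) mpoly) set) =
    (\<Sum>p\<in>carrier P. \<Sum>S\<in>full_subsets P p. (fps_X / (1 - fps_X)) ^ card S)"
proof (rule fps_ext)
  fix n
  have "card (full_monomials P n) =
      (\<Sum>p\<in>carrier P. card (\<Union>S\<in>full_subsets P p. supported_monomials S n))"
    unfolding full_monomials_def
    by (intro card_SigmaI finite_carrier ballI finite_UN_I finite_full_subsets
        finite_supported_monomials finite_full_subset)
  also have "\<dots> = (\<Sum>p\<in>carrier P. \<Sum>S\<in>full_subsets P p. card (supported_monomials S n))"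
  proof (intro sum.cong HOL.refl card_UN_disjoint finite_full_subsets ballI impI)
    show "finite (supported_monomials S n)" if "S \<in> full_subsets P p" for p S
      using that by (intro finite_supported_monomials finite_full_subset)
    show "supported_monomials S n \<inter> supported_monomials T n = {}" if "S \<noteq> T" for S T :: "'a set"
      using that by (auto simp: supported_monomials_def)
  qed
  finally have "of_nat (card (full_monomials P n)) =
      (\<Sum>p\<in>carrier P. \<Sum>S\<in>full_subsets P p. of_nat (card (supported_monomials S n)) :: rat)"
    by simp
  also have "\<dots> = (\<Sum>p\<in>carrier P. \<Sum>S\<in>full_subsets P p.
      fps_nth ((fps_X / (1 - fps_X)) ^ card S) n)"
    by (intro sum.cong HOL.refl) (simp flip: card_supported_monomials_fps add: finite_full_subset)
  finally show "fps_nth (poincare_series family_scale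
      (stanley_reisner_part P :: nat \<Rightarrow> ('a \<Rightarrow> ('a, 'k) mpoly) set)) n =
    fps_nth (\<Sum>p\<in>carrier P. \<Sum>S\<in>full_subsets P p. (fps_X / (1 - fps_X)) ^ card S) n"
    by (simp add: poincare_series_def free_rank_stanley_reisner_part fps_sum_nth)
qed

end

section \<open>The Poincare series\<close>

theorem proposition7p6:
  fixes P :: "('a, 'b) gorder_scheme"
  assumes "polyhedral_poset P"
    and "regular_poset P"
  shows "(\<forall>n. free_finite_rank family_scale
              (stanley_reisner_part P n :: ('a \<Rightarrow> ('a, 'k::comm_ring_1) mpoly) set)) \<and>
         (\<lambda>j. let i = int j - 1 in
              fps_const (of_nat (f_num P i +
                  (\<Sum>k = i + 1..poset_norm P. f_num P k * nu_num P i k))) *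
                fps_X ^ nat (i + 1) / (1 - fps_X) ^ nat (i + 1))
           sums poincare_series family_scale
              (stanley_reisner_part P :: nat \<Rightarrow> ('a \<Rightarrow> ('a, 'k) mpoly) set)"
proof -
  interpret regular_polyhedral_poset P
    using assms by (simp add: regular_polyhedral_poset_def regular_polyhedral_poset_axioms_def)
  define N where "N = Max ((\<lambda>x. card (vertices_below P x)) ` carrier P)"
  define a where "a j = (\<Sum>x\<in>carrier P. card {S \<in> full_subsets P x. card S = j})" for j
  let ?G = "fps_X / (1 - fps_X) :: rat fps"
  have card_le: "card S \<le> N" if x: "x \<in> carrier P" and S: "S \<in> full_subsets P x" for x S
  proof -
    have "card S \<le> card (vertices_below P x)"
      using S by (intro card_mono finite_vertices_below full_subset_vertices_below)
    also have "\<dots> \<le> N" unfolding N_def using x finite_carrier by (intro Max_ge) auto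
    finally show ?thesis .
  qed
  have coeff: "a j = f_num P (int j - 1) +
      (\<Sum>k = int j - 1 + 1..poset_norm P. f_num P k * nu_num P (int j - 1) k)" for j
    using sum_card_full_subsets[of j] by (simp add: a_def)
  \<comment> \<open>\<open>1 - t\<close> is a unit, so the quotient of the powers is the power of the quotient.\<close>
  have summand: "(let i = int j - 1 in
        fps_const (of_nat (f_num P i +
            (\<Sum>k = i + 1..poset_norm P. f_num P k * nu_num P i k))) *
          fps_X ^ nat (i + 1) / (1 - fps_X) ^ nat (i + 1)) = of_nat (a j) * ?G ^ j" for j
  proof -
    have "fps_nth ((1 - fps_X :: rat fps) ^ j) 0 \<noteq> 0" by (simp add: fps_nth_power_0)
    then have "f * fps_X ^ j / (1 - fps_X) ^ j = f * ?G ^ j" for f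
      by (simp add: fps_divide_unit power_mult_distrib fps_inverse_power mult.assoc)
    then show ?thesis unfolding Let_def coeff[symmetric] by (simp add: fps_of_nat)
  qed
  have "a j = 0" if "j \<notin> {..N}" for j
  proof -
    have "{S \<in> full_subsets P x. card S = j} = {}" if "x \<in> carrier P" for x
      using \<open>j \<notin> {..N}\<close> card_le[OF that] by auto
    then show ?thesis unfolding a_def by (intro sum.neutral ballI) (simp only: card.empty)
  qed
  then have "(\<lambda>j. of_nat (a j) * ?G ^ j) sums (\<Sum>j\<le>N. of_nat (a j) * ?G ^ j)"
    by (intro sums_finite) auto
  moreover have "(\<Sum>j\<le>N. of_nat (a j) * ?G ^ j) = (\<Sum>x\<in>carrier P. \<Sum>S\<in>full_subsets P x. ?G ^ card S)"
  proof -
    have "(\<Sum>S\<in>full_subsets P x. ?G ^ card S) =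
        (\<Sum>j\<le>N. of_nat (card {S \<in> full_subsets P x. card S = j}) * ?G ^ j)"
      if x: "x \<in> carrier P" for x
    proof -
      have "(\<Sum>S\<in>full_subsets P x. ?G ^ card S) =
          (\<Sum>j\<le>N. \<Sum>S\<in>{S \<in> full_subsets P x. card S = j}. ?G ^ card S)"
        using card_le[OF x] finite_full_subsets by (intro sum.group[symmetric]) auto
      then show ?thesis by simp
    qed
    then have "(\<Sum>x\<in>carrier P. \<Sum>S\<in>full_subsets P x. ?G ^ card S) =
        (\<Sum>x\<in>carrier P. \<Sum>j\<le>N. of_nat (card {S \<in> full_subsets P x. card S = j}) * ?G ^ j)"
      by simp
    also have "\<dots> = (\<Sum>j\<le>N. of_nat (a j) * ?G ^ j)"
      by (subst sum.swap) (simp add: a_def sum_distrib_right)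
    finally show ?thesis by simp
  qed
  ultimately show ?thesis
    unfolding summand by (auto simp: stanley_reisner_part_free poincare_series_eq_sum)
qed

end
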